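(* Let $k\ge 0$ be an integer and let $\zeta$ be a primitive root of unity of order $2k+1$. Define, for $|q|<1$, \[ S_2(1;q):=2\sum_{n= 0}^{\infty}\frac{q^{n+1}(-q;q)_{2n}}{(q;q^2)_{n+1}^2}. \] Then, as $q$ approaches $\zeta$ radially within the unit disk, \[ \lim_{q\rightarrow \zeta}\Big ( 2S_2(1;q)-\frac{\overline{J}_{1,2}^3}{2J_{1,4}^2}\Big)=-2\sum_{n=0}^{k}\frac{(\zeta;\zeta^2)_n^2\,\zeta^{2n+1}}{(-\zeta;\zeta)_{2n+1}}. \]
   Context: Throughout, $q$ is a complex number with $0<|q|<1$. For $x\in\mathbb{C}$ and $n\ge 0$, $(x;q)_n:=\prod_{i=0}^{n-1}(1-xq^i)$ (also used with any other base, e.g. $(x;\zeta^2)_n=\prod_{i=0}^{n-1}(1-x\zeta^{2i})$) and $(x;q)_\infty:=\prod_{i\ge 0}(1-xq^i)$. The theta function is $j(x;q):=(x;q)_\infty(q/x;q)_\infty(q;q)_\infty$. For integers $a$ and $m>0$: $J_{a,m}:=j(q^a;q^m)$ and $\overline{J}_{a,m}:=j(-q^a;q^m)$. "$q$ approaches $\zeta$ radially" means $q=r\zeta$ with $r\to 1^-$. *)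

theory Defs
  imports "HOL-Analysis.Analysis"
begin

definition qpoch :: "complex \<Rightarrow> complex \<Rightarrow> nat \<Rightarrow> complex" where
  "qpoch x q n = (\<Prod>i<n. 1 - x * q ^ i)"

definition qpoch_inf :: "complex \<Rightarrow> complex \<Rightarrow> complex" where
  "qpoch_inf x q = (\<Prod>i. 1 - x * q ^ i)"

text \<open>The theta function \<open>j(x;q) = (x;q)\<^sub>\<infinity> (q/x;q)\<^sub>\<infinity> (q;q)\<^sub>\<infinity>\<close>, for \<open>x \<noteq> 0\<close> and \<open>0 < |q| < 1\<close>.\<close>

definition theta_j :: "complex \<Rightarrow> complex \<Rightarrow> complex" where
  "theta_j x q = qpoch_inf x q * qpoch_inf (q / x) q * qpoch_inf q q"

text \<open>\<open>J\<^sub>a\<^sub>,\<^sub>m\<close> and its barred version, as functions of the nome \<open>q\<close>; they are meant for \<open>m > 0\<close>.\<close>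

definition theta_J :: "int \<Rightarrow> nat \<Rightarrow> complex \<Rightarrow> complex" where
  "theta_J a m q = theta_j (q powi a) (q ^ m)"

definition theta_J_bar :: "int \<Rightarrow> nat \<Rightarrow> complex \<Rightarrow> complex" where
  "theta_J_bar a m q = theta_j (- (q powi a)) (q ^ m)"

text \<open>The function \<open>S\<^sub>2(1;q)\<close>. For \<open>|q| < 1\<close> the denominators do not vanish and the series
  converges.\<close>

definition S2_one :: "complex \<Rightarrow> complex" where
  "S2_one q = 2 * (\<Sum>n. q ^ (n + 1) * qpoch (- q) q (2 * n) / (qpoch q (q ^ 2) (n + 1)) ^ 2)"

definition primitive_root_of_unity :: "nat \<Rightarrow> complex \<Rightarrow> bool" where
  "primitive_root_of_unity n z \<longleftrightarrow> n > 0 \<and> z ^ n = 1 \<and> (\<forall>m. 0 < m \<and> m < n \<longrightarrow> z ^ m \<noteq> 1)"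

end

theory Submission
  imports Defs "HOL-Complex_Analysis.Complex_Analysis"
begin

text \<open>Let \<open>\<theta>(x) = \<Sum> q\<^sup>n\<^sup>(\<^sup>n\<^sup>+\<^sup>1\<^sup>) x\<^sup>n\<close> and \<open>a(x) = \<Sum> q\<^sup>n\<^sup>(\<^sup>n\<^sup>+\<^sup>1\<^sup>) x\<^sup>n / (1 + q\<^sup>2\<^sup>n)\<close> be summed over all
  integers. Clearing the poles of \<open>S\<^sub>2(x;q)\<close> gives a function \<open>E(x)\<close> on the punctured plane whose
  values at \<open>x\<close> and \<open>q\<^sup>2 x\<close> are related by telescoping. The combination
  \<open>\<theta>(x) E(x) + a(x) (xq;q\<^sup>2)\<^sub>\<infinity> (q/x;q\<^sup>2)\<^sub>\<infinity>\<close> then transforms like, and is therefore a multiple of,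
  \<open>(-xq;q\<^sup>2)\<^sub>\<infinity> (-q/x;q\<^sup>2)\<^sub>\<infinity>\<close>. The multiple is found at \<open>x = q\<close>, and \<open>x = 1\<close> shows that the
  function under the limit equals \<open>- 2 a(1) / \<theta>(1)\<close>.

  Put \<open>p = 2 k + 1\<close>. Since \<open>a(q\<^sup>2 x) + a(x) = \<theta>(x)\<close>, iterating \<open>p\<close> times gives
  \<open>a(q\<^sup>2\<^sup>p) + a(1) = \<theta>(1) \<Sum>\<^sub>i\<^sub><\<^sub>p (-1)\<^sup>i q\<^sup>-\<^sup>i\<^sup>(\<^sup>i\<^sup>+\<^sup>1\<^sup>)\<close>. For \<open>q = r \<zeta>\<close> the argument \<open>q\<^sup>2\<^sup>p = r\<^sup>2\<^sup>p\<close>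
  tends to \<open>1\<close>, and \<open>a(q\<^sup>2\<^sup>p) - a(1)\<close> is negligible against \<open>\<theta>(1)\<close>, which grows like
  \<open>\<Sum> r\<^sup>n\<^sup>(\<^sup>n\<^sup>+\<^sup>1\<^sup>)\<close> because the Gauss sum \<open>\<Sum>\<^sub>n\<^sub><\<^sub>p \<zeta>\<^sup>n\<^sup>(\<^sup>n\<^sup>+\<^sup>1\<^sup>)\<close> is nonzero. So the limit is
  \<open>- \<Sum>\<^sub>i\<^sub><\<^sub>p (-1)\<^sup>i \<zeta>\<^sup>-\<^sup>i\<^sup>(\<^sup>i\<^sup>+\<^sup>1\<^sup>)\<close>. The terms of the finite sum in the theorem are those of \<open>S\<^sub>2\<close>
  continued to negative indices, so the same telescoping at \<open>q = \<zeta>\<close> evaluates it, because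
  \<open>x \<mapsto> \<zeta>\<^sup>2 x\<close> has period \<open>p\<close> on the \<open>p\<close>-th roots of unity.\<close>

section \<open>Infinite q-products\<close>

lemma summable_qfactor:
  fixes q :: complex
  assumes "norm q < 1"
  shows "summable (\<lambda>i. norm ((1 - x * q ^ i) - 1))"
  using assms by (simp add: norm_mult norm_power summable_mult summable_geometric)

lemma convergent_qfactor:
  fixes q :: complex
  assumes "norm q < 1"
  shows "convergent_prod (\<lambda>i. 1 - x * q ^ i)"
  by (intro abs_convergent_prod_imp_convergent_prod summable_imp_abs_convergent_prod
      summable_qfactor assms)

lemma qpoch_LIMSEQ:
  assumes "norm q < 1"
  shows "qpoch x q \<longlonglongrightarrow> qpoch_inf x q"
  using convergent_prod_LIMSEQ[OF convergent_qfactor[OF assms, of x]]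
  unfolding qpoch_def qpoch_inf_def by (simp add: LIMSEQ_lessThan_iff_atMost)

lemma qpoch_0 [simp]: "qpoch x q 0 = 1"
  by (simp add: qpoch_def)

lemma qpoch_Suc: "qpoch x q (Suc n) = qpoch x q n * (1 - x * q ^ n)"
  by (simp add: qpoch_def)

lemma qpoch_shift: "qpoch x q (n + m) = qpoch x q n * qpoch (x * q ^ n) q m"
  by (induction m) (simp_all add: qpoch_Suc power_add mult_ac)

lemma qpoch_inf_shift:
  assumes "norm q < 1"
  shows "qpoch_inf x q = qpoch x q n * qpoch_inf (x * q ^ n) q"
proof (rule LIMSEQ_unique)
  show "(\<lambda>m. qpoch x q (n + m)) \<longlonglongrightarrow> qpoch_inf x q"
    using LIMSEQ_ignore_initial_segment[OF qpoch_LIMSEQ[OF assms], of x n] by (simp add: add.commute)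
  show "(\<lambda>m. qpoch x q (n + m)) \<longlonglongrightarrow> qpoch x q n * qpoch_inf (x * q ^ n) q"
    unfolding qpoch_shift by (intro tendsto_intros qpoch_LIMSEQ assms)
qed

lemma qpoch_inf_step:
  assumes "norm q < 1"
  shows "qpoch_inf x q = (1 - x) * qpoch_inf (x * q) q"
  using qpoch_inf_shift[OF assms, of x 1] by (simp add: qpoch_def)

lemma qpoch_inf_nonzero:
  assumes "norm q < 1" "\<And>i. x * q ^ i \<noteq> 1"
  shows "qpoch_inf x q \<noteq> 0"
  unfolding qpoch_inf_def
  by (rule prodinf_nonzero[OF convergent_qfactor[OF assms(1)]]) (metis assms(2) eq_iff_diff_eq_0)

lemma qpoch_inf_nonzero_small:
  assumes "norm q < 1" "norm x < 1"
  shows "qpoch_inf x q \<noteq> 0"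
proof (rule qpoch_inf_nonzero[OF assms(1)])
  fix i
  have "norm (x * q ^ i) \<le> norm x * 1"
    unfolding norm_mult norm_power using assms(1) by (intro mult_left_mono power_le_one) auto
  also have "\<dots> < 1" using assms by simp
  finally show "x * q ^ i \<noteq> 1" by force
qed

lemma qpoch_inf_eq_0:
  assumes "norm q < 1" "x * q ^ i = 1"
  shows "qpoch_inf x q = 0"
  using qpoch_inf_shift[OF assms(1), of x "Suc i"] assms(2) by (simp add: qpoch_Suc)

text \<open>Each factor is at most exp(|x| |q|^i), and the exponents form a geometric series. The
  bound is independent of \<open>n\<close>, as the later dominated convergence arguments
  require.\<close>

lemma norm_qpoch_le:
  assumes "norm q < 1"
  shows "norm (qpoch x q n) \<le> exp (norm x / (1 - norm q))"
proof -
  have "norm (qpoch x q n) \<le> (\<Prod>i<n. exp (norm x * norm q ^ i))"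
    unfolding qpoch_def prod_norm [symmetric]
  proof (intro prod_mono conjI norm_ge_zero)
    fix i
    have "norm (1 - x * q ^ i) \<le> 1 + norm x * norm q ^ i"
      using norm_triangle_ineq4[of 1 "x * q ^ i"] by (simp add: norm_mult norm_power)
    also have "\<dots> \<le> exp (norm x * norm q ^ i)" by (rule exp_ge_add_one_self)
    finally show "norm (1 - x * q ^ i) \<le> exp (norm x * norm q ^ i)" .
  qed
  also have "\<dots> = exp (\<Sum>i<n. norm x * norm q ^ i)" by (simp add: exp_sum)
  also have "(\<Sum>i<n. norm x * norm q ^ i) \<le> (\<Sum>i. norm x * norm q ^ i)"
    using assms by (intro sum_le_suminf summable_mult summable_geometric) auto
  also have "(\<Sum>i. norm x * norm q ^ i) = norm x / (1 - norm q)"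
    using assms by (simp add: suminf_mult suminf_geometric summable_geometric)
  finally show ?thesis by simp
qed

lemma norm_qpoch_inf_le:
  assumes "norm q < 1"
  shows "norm (qpoch_inf x q) \<le> exp (norm x / (1 - norm q))"
  by (rule Lim_bounded[OF tendsto_norm[OF qpoch_LIMSEQ[OF assms]]]) (simp add: norm_qpoch_le assms)

text \<open>The majorant (|x| + 1) |q|^i gives uniform convergence of the partial products on the
  closed unit disk around every point, and these partial products are polynomials.\<close>

lemma qpoch_inf_holomorphic:
  assumes "norm q < 1"
  shows "(\<lambda>x. qpoch_inf x q) holomorphic_on A"
proof -
  have "(\<lambda>x. qpoch_inf x q) holomorphic_on UNIV"
  proof (rule holomorphic_uniform_sequence[of _ "\<lambda>n x. qpoch x q n"])
    show "(\<lambda>x. qpoch x q n) holomorphic_on UNIV" for n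
      unfolding qpoch_def by (intro holomorphic_intros)
    fix x :: complex
    have "uniformly_convergent_on (cball x 1) (\<lambda>N y. \<Prod>i<N. 1 - y * q ^ i)"
    proof (rule uniformly_convergent_on_prod')
      show "uniformly_convergent_on (cball x 1) (\<lambda>N y. \<Sum>i<N. norm (1 - y * q ^ i - 1))"
      proof (rule Weierstrass_m_test'[where M = "\<lambda>i. (norm x + 1) * norm q ^ i"])
        fix i y assume "y \<in> cball x 1"
        then have "norm y \<le> norm x + 1"
          using norm_triangle_ineq2[of y x] by (simp add: dist_norm norm_minus_commute)
        then show "norm (norm (1 - y * q ^ i - 1)) \<le> (norm x + 1) * norm q ^ i"
          by (simp add: norm_mult norm_power mult_right_mono)
      qed (use assms in \<open>simp add: summable_mult summable_geometric\<close>)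
    qed (auto intro!: continuous_intros)
    then obtain l where l: "uniform_limit (cball x 1) (\<lambda>N y. qpoch y q N) l sequentially"
      unfolding qpoch_def uniformly_convergent_on_def by blast
    have "l y = qpoch_inf y q" if "y \<in> cball x 1" for y
      using tendsto_uniform_limitI[OF l that] qpoch_LIMSEQ[OF assms, of y] LIMSEQ_unique by blast
    with l have "uniform_limit (cball x 1) (\<lambda>N y. qpoch y q N) (\<lambda>x. qpoch_inf x q) sequentially"
      using uniform_limit_cong'[of "cball x 1" "\<lambda>N y. qpoch y q N" "\<lambda>N y. qpoch y q N" l
          "\<lambda>y. qpoch_inf y q"] by simp
    then show "\<exists>d>0. cball x d \<subseteq> UNIV \<and>
        uniform_limit (cball x d) (\<lambda>n x. qpoch x q n) (\<lambda>x. qpoch_inf x q) sequentially"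
      by (intro exI[of _ 1]) auto
  qed auto
  then show ?thesis using holomorphic_on_subset by blast
qed

lemma qpoch_inf_holomorphic_comp:
  assumes "norm q < 1" "f holomorphic_on A"
  shows "(\<lambda>x. qpoch_inf (f x) q) holomorphic_on A"
  using holomorphic_on_compose[OF assms(2) qpoch_inf_holomorphic[OF assms(1)]] by (simp add: o_def)

lemma isCont_qpoch_inf:
  assumes "norm q < 1"
  shows "isCont (\<lambda>x. qpoch_inf x q) x"
  using holomorphic_on_imp_continuous_on[OF qpoch_inf_holomorphic[OF assms, of UNIV]]
  by (simp add: continuous_on_eq_continuous_at)

lemma qpoch_inf_0 [simp]: "qpoch_inf 0 q = 1"
  by (simp add: qpoch_inf_def)

section \<open>Dissections of q-products and two identities of Euler\<close>

lemma qpoch_even_odd: "qpoch x q (2 * n) = qpoch x (q\<^sup>2) n * qpoch (x * q) (q\<^sup>2) n"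
  by (induction n) (simp_all add: qpoch_Suc power_mult [symmetric] mult_ac flip: power_Suc)

lemma qpoch_inf_even_odd:
  assumes "norm q < 1"
  shows "qpoch_inf x q = qpoch_inf x (q\<^sup>2) * qpoch_inf (x * q) (q\<^sup>2)"
proof (rule LIMSEQ_unique)
  have q2: "norm (q\<^sup>2) < 1" using assms by (simp add: norm_power power_less_one_iff)
  have "(\<lambda>n. qpoch x q (2 * n)) \<longlonglongrightarrow> qpoch_inf x q"
    by (rule filterlim_compose[OF qpoch_LIMSEQ[OF assms]])
      (simp add: filterlim_at_top_mult_tendsto_pos mult_nat_left_at_top)
  then show "(\<lambda>n. qpoch x (q\<^sup>2) n * qpoch (x * q) (q\<^sup>2) n) \<longlonglongrightarrow> qpoch_inf x q"
    by (simp add: qpoch_even_odd)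
  show "(\<lambda>n. qpoch x (q\<^sup>2) n * qpoch (x * q) (q\<^sup>2) n) \<longlonglongrightarrow>
      qpoch_inf x (q\<^sup>2) * qpoch_inf (x * q) (q\<^sup>2)"
    by (intro tendsto_intros qpoch_LIMSEQ q2)
qed

lemma qpoch_inf_square:
  assumes "norm q < 1"
  shows "qpoch_inf x q * qpoch_inf (- x) q = qpoch_inf (x\<^sup>2) (q\<^sup>2)"
proof (rule LIMSEQ_unique)
  have q2: "norm (q\<^sup>2) < 1" using assms by (simp add: norm_power power_less_one_iff)
  show "(\<lambda>n. qpoch x q n * qpoch (- x) q n) \<longlonglongrightarrow> qpoch_inf x q * qpoch_inf (- x) q"
    by (intro tendsto_intros qpoch_LIMSEQ assms)
  have "qpoch x q n * qpoch (- x) q n = qpoch (x\<^sup>2) (q\<^sup>2) n" for n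
    by (simp add: qpoch_def prod.distrib [symmetric])
      (intro prod.cong, auto simp: algebra_simps power2_eq_square power_mult_distrib)
  then show "(\<lambda>n. qpoch x q n * qpoch (- x) q n) \<longlonglongrightarrow> qpoch_inf (x\<^sup>2) (q\<^sup>2)"
    by (simp add: qpoch_LIMSEQ q2)
qed

text \<open>The inner product is \<open>(-q;q)\<^sub>\<infinity>\<close>, split by the parity of the exponents.\<close>

lemma euler_odd_distinct:
  assumes "norm q < 1"
  shows "qpoch_inf q (q\<^sup>2) * (qpoch_inf (- q) (q\<^sup>2) * qpoch_inf (- (q\<^sup>2)) (q\<^sup>2)) = 1"
proof -
  have nz: "qpoch_inf q q \<noteq> 0" by (rule qpoch_inf_nonzero_small) (use assms in auto)
  have "qpoch_inf q q = qpoch_inf q (q\<^sup>2) * qpoch_inf (q\<^sup>2) (q\<^sup>2)"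
    using qpoch_inf_even_odd[OF assms, of q] by (simp add: power2_eq_square)
  also have "qpoch_inf (q\<^sup>2) (q\<^sup>2) = qpoch_inf q q * qpoch_inf (- q) q"
    by (rule qpoch_inf_square[OF assms, symmetric])
  also have "qpoch_inf (- q) q = qpoch_inf (- q) (q\<^sup>2) * qpoch_inf (- (q\<^sup>2)) (q\<^sup>2)"
    using qpoch_inf_even_odd[OF assms, of "- q"] by (simp add: power2_eq_square)
  finally show ?thesis using nz by (simp add: field_simps)
qed

text \<open>The coefficients give f(zq) = (1 - z) f(z). Iteration drives the argument to 0, where
  continuity and f(0) = 1 leave the infinite product.\<close>

lemma euler_exp_sums:
  assumes q: "norm q < 1" and z: "norm z < 1"
  shows "(\<lambda>n. z ^ n / qpoch q q n) sums (1 / qpoch_inf z q)"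
proof -
  define f where "f z = (\<Sum>n. z ^ n / qpoch q q n)" for z
  have nzi: "qpoch_inf q q \<noteq> 0" by (rule qpoch_inf_nonzero_small) (use assms in auto)
  have nz: "qpoch q q n \<noteq> 0" for n
    using nzi qpoch_inf_shift[OF q, of q n] by auto
  have "Bseq (\<lambda>n. inverse (qpoch q q n))"
    \<comment> \<open>The finite products converge to a nonzero limit, so their reciprocals are
      bounded and the series has a geometric majorant.\<close>
    by (rule convergent_imp_Bseq)
      (use tendsto_inverse[OF qpoch_LIMSEQ[OF q, of q] nzi] in \<open>auto simp: convergent_def\<close>)
  then obtain B where B: "\<And>n. norm (inverse (qpoch q q n)) \<le> B" "B > 0"
    by (auto simp: Bseq_def)
  have summ: "summable (\<lambda>n. z ^ n / qpoch q q n)" if "norm z < 1" for z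
  proof (rule summable_comparison_test')
    show "summable (\<lambda>n. B * norm z ^ n)" using that by (intro summable_mult summable_geometric) auto
    show "norm (z ^ n / qpoch q q n) \<le> B * norm z ^ n" for n
      using mult_right_mono[OF B(1)[of n], of "norm z ^ n"]
      by (simp add: norm_mult norm_divide norm_inverse norm_power field_simps)
  qed
  have fe: "f (z * q) = (1 - z) * f z" if z: "norm z < 1" for z
  proof -
    have zq: "norm (z * q) < 1" using mult_strict_mono'[OF z q] by (simp add: norm_mult)
    have "z * (z ^ n / qpoch q q n) = z ^ Suc n / qpoch q q (Suc n) - (z * q) ^ Suc n / qpoch q q (Suc n)" for n
    proof -
      have "1 - q * q ^ n \<noteq> 0" using nz[of "Suc n"] by (simp add: qpoch_Suc)
      then have "z * (z ^ n / qpoch q q n)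
          = z ^ Suc n * (1 - q * q ^ n) / (qpoch q q n * (1 - q * q ^ n))"
        by simp
      also have "\<dots> = z ^ Suc n / qpoch q q (Suc n) - (z * q) ^ Suc n / qpoch q q (Suc n)"
        by (simp add: qpoch_Suc right_diff_distrib power_mult_distrib diff_divide_distrib mult_ac)
      finally show ?thesis .
    qed
    then have "z * f z = (\<Sum>n. z ^ Suc n / qpoch q q (Suc n) - (z * q) ^ Suc n / qpoch q q (Suc n))"
      unfolding f_def by (subst suminf_mult[symmetric]) (auto intro!: summ z)
    also have "\<dots> = (\<Sum>n. z ^ Suc n / qpoch q q (Suc n)) - (\<Sum>n. (z * q) ^ Suc n / qpoch q q (Suc n))"
      by (intro suminf_diff [symmetric])
        (use summ[OF z, THEN summable_ignore_initial_segment[where k = 1]]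
             summ[OF zq, THEN summable_ignore_initial_segment[where k = 1]] in auto)
    also have "\<dots> = f z - f (z * q)"
      unfolding f_def using suminf_split_head[OF summ[OF z]] suminf_split_head[OF summ[OF zq]] by simp
    finally show ?thesis by (simp add: algebra_simps)
  qed
  have znq: "norm (z * q ^ n) < 1" for n
  proof -
    have "norm (z * q ^ n) \<le> norm z * 1"
      unfolding norm_mult norm_power using q by (intro mult_left_mono power_le_one) auto
    then show ?thesis using z by simp
  qed
  have iter: "f (z * q ^ n) = qpoch z q n * f z" for n
    by (induction n) (use fe[OF znq] in \<open>simp_all add: qpoch_Suc mult_ac\<close>)
  have "isCont f 0"
  proof -
    have "f holomorphic_on ball 0 1"
      unfolding f_def
      by (rule power_series_holomorphic[where a = "\<lambda>n. inverse (qpoch q q n)"])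
        (use summ in \<open>auto simp: dist_norm divide_inverse mult_ac intro: summable_sums\<close>)
    then show ?thesis
      using holomorphic_on_imp_continuous_on continuous_on_eq_continuous_at[OF open_ball, of 0 1 f] by auto
  qed
  moreover have "(\<lambda>n. z * q ^ n) \<longlonglongrightarrow> 0"
    using tendsto_mult_right_zero[OF LIMSEQ_power_zero[OF q], of z] by simp
  ultimately have "(\<lambda>n. f (z * q ^ n)) \<longlonglongrightarrow> f 0"
    by (rule isCont_tendsto_compose)
  moreover have "(\<lambda>n. f (z * q ^ n)) \<longlonglongrightarrow> qpoch_inf z q * f z"
    unfolding iter by (intro tendsto_intros qpoch_LIMSEQ q)
  ultimately have "qpoch_inf z q * f z = f 0" by (rule LIMSEQ_unique[rotated])
  also have "f 0 = 1"
  proof -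
    have "f 0 = (\<Sum>n\<in>{0}. 0 ^ n / qpoch q q n)" unfolding f_def by (rule suminf_finite) auto
    then show ?thesis by simp
  qed
  finally have "f z = 1 / qpoch_inf z q"
    using qpoch_inf_nonzero_small[OF q z] by (simp add: field_simps)
  then show ?thesis using summable_sums[OF summ[OF z]] by (simp add: f_def)
qed

text \<open>A local Weierstrass test. It serves the Eulerian series, which is not a power series in
  \<open>x\<close> and lives on the punctured plane.\<close>

lemma suminf_holomorphic:
  fixes f :: "nat \<Rightarrow> complex \<Rightarrow> complex"
  assumes S: "open S" and hol: "\<And>n. f n holomorphic_on S"
    and bound: "\<And>x. x \<in> S \<Longrightarrow> \<exists>d h. 0 < d \<and> summable h \<and> (\<forall>n. \<forall>y \<in> ball x d \<inter> S. norm (f n y) \<le> h n)"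
  shows "(\<lambda>x. \<Sum>n. f n x) holomorphic_on S"
proof -
  have "\<exists>g g'. \<forall>x\<in>S. ((\<lambda>n. f n x) sums g x) \<and> ((\<lambda>n. deriv (f n) x) sums g' x) \<and>
      (g has_field_derivative g' x) (at x)"
  proof (rule series_and_derivative_comparison_complex[OF S])
    show "(f n has_field_derivative deriv (f n) x) (at x)" if "x \<in> S" for n x
      by (rule holomorphic_derivI[OF hol S that])
    fix x assume x: "x \<in> S"
    then obtain d h where dh: "0 < d" "summable h" "\<And>n y. y \<in> ball x d \<inter> S \<Longrightarrow> norm (f n y) \<le> h n"
      using bound by metis
    have h0: "h n \<ge> 0" for n
      using order_trans[OF norm_ge_zero dh(3)[of x n]] x dh(1) by simp
    show "\<exists>d h. 0 < d \<and> summable h \<and> range h \<subseteq> \<real>\<^sub>\<ge>\<^sub>0 \<and>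
        (\<forall>\<^sub>F n in sequentially. \<forall>y\<in>ball x d \<inter> S. cmod (f n y) \<le> cmod (h n))"
      by (rule exI[of _ d], rule exI[of _ "\<lambda>n. complex_of_real (h n)"])
        (use dh h0 in \<open>auto simp: summable_of_real_iff nonneg_Reals_of_real_iff\<close>)
  qed
  then obtain g g' where g: "\<And>x. x \<in> S \<Longrightarrow> (\<lambda>n. f n x) sums g x"
    "\<And>x. x \<in> S \<Longrightarrow> (g has_field_derivative g' x) (at x)" by metis
  have "g holomorphic_on S" using g(2) S by (auto simp: holomorphic_on_open)
  then show ?thesis
    by (rule holomorphic_transform) (use g(1) in \<open>auto simp: sums_iff\<close>)
qed

section \<open>Uniqueness of theta functions\<close>

lemma norm_power2_less_1:
  fixes q :: complex
  assumes "norm q < 1"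
  shows "norm (q\<^sup>2) < 1"
  using assms by (simp add: norm_power power_less_one_iff)

text \<open>A solution \<open>k\<close> vanishes at \<open>-q\<close>, the only zero of the theta product in a fundamental annulus
  of the map \<open>x \<mapsto> q\<^sup>2 x\<close>, so the quotient is holomorphic and invariant under this map, and
  therefore attains its maximum modulus in the interior.\<close>

lemma theta_unique:
  fixes q :: complex and k :: "complex \<Rightarrow> complex"
  assumes q: "q \<noteq> 0" "norm q < 1"
    and hol: "k holomorphic_on - {0}"
    and quasi: "\<And>x. x \<noteq> 0 \<Longrightarrow> k (q\<^sup>2 * x) = k x / (q * x)"
    and sym: "\<And>x. x \<noteq> 0 \<Longrightarrow> k (1 / x) = k x"
  obtains K where "\<And>x. norm q ^ 3 < norm x \<Longrightarrow> norm x < 1 / norm q \<Longrightarrow>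
    k x = K * (qpoch_inf (- (x * q)) (q\<^sup>2) * qpoch_inf (- (q / x)) (q\<^sup>2))"
proof -
  \<comment> \<open>The zeros of the theta product are the points -q^(2j+1) for integers j. The
    moduli |q|^3 and 1/|q| are excluded, so only -q remains in \<open>D\<close>.\<close>
  define D where "D = {x :: complex. norm q ^ 3 < norm x \<and> norm x < 1 / norm q}"
  define \<Phi> where "\<Phi> x = qpoch_inf (- (x * q)) (q\<^sup>2) * qpoch_inf (- (q / x)) (q\<^sup>2)" for x
  define \<psi> where "\<psi> x = qpoch_inf (- (x * q)) (q\<^sup>2) * qpoch_inf (- (q ^ 3 / x)) (q\<^sup>2) / x" for x
  note q2 = norm_power2_less_1[OF q(2)]
  have nq: "0 < norm q" using q by simp
  have pw: "norm q ^ 3 < norm q ^ 2" "norm q ^ 2 < norm q" "norm q ^ 3 < norm q" "1 < 1 / norm q"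
    using nq q(2) power_strict_decreasing[of 2 3 "norm q"] power_strict_decreasing[of 1 2 "norm q"]
    power_strict_decreasing[of 1 3 "norm q"] by simp_all
  have D0: "0 \<notin> D" using nq by (auto simp: D_def)
  have oD: "open D" unfolding D_def by (intro open_Collect_conj open_Collect_less continuous_intros)
  have cD: "connected D" unfolding D_def using connected_annulus(1)[of "norm q ^ 3" "0::complex" "1 / norm q"] by simp
  have aD: "- q \<in> D" using pw q less_trans[OF q(2) pw(4)] by (simp add: D_def)
  \<comment> \<open>Both the inversion and the quasi-periodicity link -q with -1/q, the latter with
    factor -1, so the value is its own negative.\<close>
  have k0: "k (- q) = 0"
  proof -
    have "k (- q) = k (q\<^sup>2 * (- 1 / q))" using q by (simp add: power2_eq_square)
    also have "\<dots> = - k (- 1 / q)" using q by (subst quasi) auto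
    also have "k (- 1 / q) = k (- q)" using sym[of "- q"] q by simp
    finally show ?thesis by simp
  qed
  have split: "\<Phi> x = (x + q) * \<psi> x" if "x \<noteq> 0" for x
  proof -
    have "qpoch_inf (- (q / x)) (q\<^sup>2) = (1 + q / x) * qpoch_inf (- (q ^ 3 / x)) (q\<^sup>2)"
      using qpoch_inf_step[OF q2, of "- (q / x)"] by (simp add: power2_eq_square power3_eq_cube mult_ac)
    also have "1 + q / x = (x + q) / x" using that by (simp add: field_simps)
    finally show ?thesis by (simp add: \<Phi>_def \<psi>_def)
  qed
  have \<psi>nz: "\<psi> x \<noteq> 0" if "x \<in> D" for x
  proof -
    have "norm (- (x * q)) < 1" "norm (- (q ^ 3 / x)) < 1" "x \<noteq> 0"
      using that nq D0 by (auto simp: D_def norm_mult norm_divide norm_power divide_simps mult_ac)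
    then show ?thesis unfolding \<psi>_def using qpoch_inf_nonzero_small[OF q2] by simp
  qed
  have hol\<psi>: "\<psi> holomorphic_on D"
  proof -
    have "(\<lambda>x. qpoch_inf (- (x * q)) (q\<^sup>2)) holomorphic_on D"
      by (intro qpoch_inf_holomorphic_comp q2 holomorphic_intros)
    moreover have "(\<lambda>x. qpoch_inf (- (q ^ 3 / x)) (q\<^sup>2)) holomorphic_on D"
      by (intro qpoch_inf_holomorphic_comp q2 holomorphic_intros) (use D0 in auto)
    ultimately show ?thesis unfolding \<psi>_def using D0 by (auto intro!: holomorphic_intros)
  qed
  \<comment> \<open>The zero of \<open>k\<close> at -q is divided out; the singularity is
    removable.\<close>
  define h where "h x = (if x = - q then deriv k (- q) else (k x - k (- q)) / (x - (- q)))" for x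
  have holh: "h holomorphic_on D"
    unfolding h_def by (rule pole_lemma_open[OF holomorphic_on_subset[OF hol] oD]) (use D0 in auto)
  have kh: "k x = (x + q) * h x" for x
    using k0 by (auto simp: h_def add_eq_0_iff)
  define f where "f x = h x / \<psi> x" for x
  have holf: "f holomorphic_on D"
    unfolding f_def using holh hol\<psi> \<psi>nz by (auto intro!: holomorphic_intros)
  have kf: "k x = f x * \<Phi> x" if "x \<in> D" for x
  proof -
    have "x \<noteq> 0" using that D0 by auto
    then show ?thesis using \<psi>nz[OF that] by (simp add: f_def kh split)
  qed
  \<comment> \<open>In this range both x and q^2 x lie in \<open>D\<close>, and x is not a zero of
    the product.\<close>
  have inv: "f (q\<^sup>2 * x) = f x" if x: "norm q < norm x" "norm x < 1 / norm q" for x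
  proof -
    have x0: "x \<noteq> 0" using x nq by auto
    have xD: "x \<in> D" using x pw by (auto simp: D_def)
    have nqx: "norm (q\<^sup>2 * x) < norm q"
      using x nq by (simp add: norm_mult norm_power power2_eq_square field_simps)
    have "norm q ^ 3 < norm (q\<^sup>2 * x)"
      using x nq by (simp add: norm_mult norm_power power3_eq_cube power2_eq_square)
    then have qxD: "q\<^sup>2 * x \<in> D" using nqx q(2) pw(4) by (auto simp: D_def)
    have qx1: "1 + q * x \<noteq> 0"
    proof
      assume "1 + q * x = 0"
      then have "norm (q * x) = 1" by (simp add: add_eq_0_iff)
      then show False using x nq by (simp add: norm_mult field_simps)
    qed
    have "\<Phi> (q\<^sup>2 * x) * (1 + q * x) = (1 + 1 / (q * x)) * \<Phi> x"
    proof -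
      have 1: "qpoch_inf (- (x * q)) (q\<^sup>2) = (1 + q * x) * qpoch_inf (- (q\<^sup>2 * x * q)) (q\<^sup>2)"
        using qpoch_inf_step[OF q2, of "- (x * q)"] by (simp add: mult_ac)
      have 2: "qpoch_inf (- (q / (q\<^sup>2 * x))) (q\<^sup>2) = (1 + 1 / (q * x)) * qpoch_inf (- (q / x)) (q\<^sup>2)"
        using qpoch_inf_step[OF q2, of "- (q / (q\<^sup>2 * x))"] q x0 by (simp add: power2_eq_square)
      show ?thesis unfolding \<Phi>_def 1 2 by (simp add: mult_ac)
    qed
    also have "1 + 1 / (q * x) = (1 + q * x) / (q * x)" using q x0 by (simp add: field_simps)
    finally have "\<Phi> (q\<^sup>2 * x) * (1 + q * x) = \<Phi> x / (q * x) * (1 + q * x)" by simp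
    then have \<Phi>q: "\<Phi> (q\<^sup>2 * x) = \<Phi> x / (q * x)" using qx1 mult_right_cancel by blast
    have "x + q \<noteq> 0" using x by (metis add_eq_0_iff2 norm_minus_cancel less_irrefl)
    then have \<Phi>nz: "\<Phi> x \<noteq> 0" using split[OF x0] \<psi>nz[OF xD] by simp
    have "f (q\<^sup>2 * x) * (\<Phi> x / (q * x)) = f x * (\<Phi> x / (q * x))"
      by (metis kf[OF qxD] kf[OF xD] quasi[OF x0] \<Phi>q times_divide_eq_right)
    moreover have "\<Phi> x / (q * x) \<noteq> 0" using \<Phi>nz q x0 by simp
    ultimately show ?thesis using mult_right_cancel by blast
  qed
  define A where "A = {x :: complex. norm q ^ 2 \<le> norm x \<and> norm x \<le> 1}"
  have AD: "A \<subseteq> D" using pw by (auto simp: A_def D_def)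
  have "compact A"
    unfolding compact_eq_bounded_closed
  proof
    show "bounded A" by (rule bounded_subset[of "cball 0 1"]) (auto simp: A_def)
    show "closed A" unfolding A_def by (intro closed_Collect_conj closed_Collect_le continuous_intros)
  qed
  moreover have "1 \<in> A" using q pw by (auto simp: A_def)
  moreover have "continuous_on A (\<lambda>x. norm (f x))"
    using holomorphic_on_imp_continuous_on[OF holomorphic_on_subset[OF holf AD]] by (intro continuous_intros)
  ultimately obtain \<xi> where \<xi>: "\<xi> \<in> A" "\<And>y. y \<in> A \<Longrightarrow> norm (f y) \<le> norm (f \<xi>)"
    using continuous_attains_sup[of A "\<lambda>x. norm (f x)"] by blast
  \<comment> \<open>One multiplication by q^2 or its inverse brings any point of \<open>D\<close>
    into the compact annulus \<open>A\<close>, so the maximum over \<open>A\<close> is a maximum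
    over the open set \<open>D\<close>.\<close>
  have max: "norm (f y) \<le> norm (f \<xi>)" if y: "y \<in> D" for y
  proof -
    consider "y \<in> A" | "norm y < norm q ^ 2" | "norm y > 1" by (force simp: A_def)
    then show ?thesis
    proof cases
      case 2
      have yq: "norm (y / q\<^sup>2) = norm y / norm q ^ 2" by (simp add: norm_divide norm_power)
      have "norm q < norm (y / q\<^sup>2)" "norm (y / q\<^sup>2) < 1"
        unfolding yq using 2 y nq by (auto simp: D_def pos_less_divide_eq pos_divide_less_eq
            power3_eq_cube power2_eq_square mult_ac)
      then have "f (q\<^sup>2 * (y / q\<^sup>2)) = f (y / q\<^sup>2)" "y / q\<^sup>2 \<in> A"
        using pw by (auto simp: A_def simp del: nonzero_mult_div_cancel_left times_divide_eq_right intro!: inv)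
      then show ?thesis using \<xi>(2)[of "y / q\<^sup>2"] q by simp
    next
      case 3
      have "norm (q\<^sup>2 * y) < norm q"
        using y nq by (simp add: D_def norm_mult norm_power power2_eq_square field_simps)
      moreover have "norm q ^ 2 \<le> norm (q\<^sup>2 * y)"
        using 3 nq by (simp add: norm_mult norm_power)
      ultimately have "q\<^sup>2 * y \<in> A" using q by (simp add: A_def)
      moreover have "f (q\<^sup>2 * y) = f y" using 3 y q by (intro inv) (auto simp: D_def)
      ultimately show ?thesis using \<xi>(2)[of "q\<^sup>2 * y"] by simp
    qed (use \<xi> in auto)
  qed
  have "f constant_on D"
    by (rule maximum_modulus_principle[OF holf oD cD oD subset_refl, of \<xi>]) (use \<xi> AD max in auto)
  then obtain K where K: "\<And>x. x \<in> D \<Longrightarrow> f x = K" by (auto simp: constant_on_def)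
  show ?thesis
    by (rule that[of K]) (use K kf in \<open>auto simp: D_def \<Phi>_def\<close>)
qed

section \<open>Bilateral theta and Appell series\<close>

definition ptheta :: "complex \<Rightarrow> complex \<Rightarrow> complex" where
  "ptheta q x = (\<Sum>n. q ^ (n * (n + 1)) * x ^ n)"

definition papp :: "complex \<Rightarrow> complex \<Rightarrow> complex" where
  "papp q x = (\<Sum>n. q ^ (Suc n * (Suc n + 1)) / (1 + q ^ (2 * Suc n)) * x ^ Suc n)"

text \<open>\<open>btheta q x\<close> and \<open>bapp q x\<close> are the bilateral series with terms \<open>q\<^sup>n\<^sup>(\<^sup>n\<^sup>+\<^sup>1\<^sup>) x\<^sup>n\<close> and
  \<open>q\<^sup>n\<^sup>(\<^sup>n\<^sup>+\<^sup>1\<^sup>) x\<^sup>n / (1 + q\<^sup>2\<^sup>n)\<close>, folded by \<open>n \<mapsto> -1 - n\<close> and \<open>n \<mapsto> -n\<close> respectively.\<close>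

definition btheta :: "complex \<Rightarrow> complex \<Rightarrow> complex" where
  "btheta q x = ptheta q x + ptheta q (1 / x) / x"

definition bapp :: "complex \<Rightarrow> complex \<Rightarrow> complex" where
  "bapp q x = 1 / 2 + papp q x + papp q (1 / x)"

lemma summable_ptheta_norm:
  fixes q x :: complex
  assumes "norm q < 1"
  shows "summable (\<lambda>n. norm (q ^ (n * (n + 1)) * x ^ n))"
proof (rule summable_comparison_test_ev)
  have "(\<lambda>n. norm (q ^ (n + 1) * x)) \<longlonglongrightarrow> 0"
    using tendsto_mult_left_zero[OF LIMSEQ_Suc[OF LIMSEQ_power_zero[OF assms]], of x]
    by (intro tendsto_norm_zero) simp
  then have "\<forall>\<^sub>F n in sequentially. norm (q ^ (n + 1) * x) < 1 / 2"
    by (rule order_tendstoD) simp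
  then show "\<forall>\<^sub>F n in sequentially. norm (norm (q ^ (n * (n + 1)) * x ^ n)) \<le> (1 / 2) ^ n"
  proof eventually_elim
    case (elim n)
    have "norm (q ^ (n * (n + 1)) * x ^ n) = norm (q ^ (n + 1) * x) ^ n"
      by (simp add: norm_mult norm_power power_mult_distrib power_mult [symmetric] power_add algebra_simps)
    also have "\<dots> \<le> (1 / 2) ^ n" using elim by (intro power_mono) auto
    finally show ?case by simp
  qed
qed (simp add: summable_geometric)

lemma norm_one_plus_ge:
  fixes q :: complex
  assumes "norm q < 1"
  shows "1 - norm q \<le> norm (1 + q ^ (2 * Suc n))"
proof -
  have "norm (q ^ (2 * Suc n)) \<le> norm q"
    using power_decreasing[of 1 "2 * Suc n" "norm q"] assms
    by (simp add: norm_power del: mult_Suc_right)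
  then show ?thesis using norm_diff_ineq[of 1 "q ^ (2 * Suc n)"] by simp
qed

lemma summable_papp_norm:
  fixes q x :: complex
  assumes "norm q < 1"
  shows "summable (\<lambda>n. norm (q ^ (Suc n * (Suc n + 1)) / (1 + q ^ (2 * Suc n)) * x ^ Suc n))"
proof (rule summable_comparison_test')
  show "summable (\<lambda>n. norm (q ^ (Suc n * (Suc n + 1)) * x ^ Suc n) / (1 - norm q))"
    using summable_ptheta_norm[OF assms, of x, THEN summable_ignore_initial_segment[where k = 1]]
    by (intro summable_divide) simp
  fix n :: nat
  show "norm (norm (q ^ (Suc n * (Suc n + 1)) / (1 + q ^ (2 * Suc n)) * x ^ Suc n))
      \<le> norm (q ^ (Suc n * (Suc n + 1)) * x ^ Suc n) / (1 - norm q)"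
  proof -
    have "norm (q ^ (Suc n * (Suc n + 1)) * x ^ Suc n) / norm (1 + q ^ (2 * Suc n))
        \<le> norm (q ^ (Suc n * (Suc n + 1)) * x ^ Suc n) / (1 - norm q)"
      using norm_one_plus_ge[OF assms, of n] assms by (intro divide_left_mono mult_pos_pos) auto
    then show ?thesis by (simp only: norm_mult norm_divide times_divide_eq_left real_norm_def abs_norm_cancel abs_mult abs_divide)
  qed
qed

lemmas summable_ptheta = summable_norm_cancel[OF summable_ptheta_norm]
lemmas summable_papp = summable_norm_cancel[OF summable_papp_norm]

lemma entire_power_series:
  fixes a :: "nat \<Rightarrow> complex"
  assumes "\<And>x. summable (\<lambda>n. a n * x ^ n)"
  shows "(\<lambda>x. \<Sum>n. a n * x ^ n) holomorphic_on A"
proof -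
  have "(\<lambda>x. \<Sum>n. a n * x ^ n) field_differentiable (at x)" for x
  proof -
    have "(\<lambda>x. \<Sum>n. a n * x ^ n) holomorphic_on ball 0 (norm x + 1)"
      by (rule power_series_holomorphic) (use assms in \<open>auto intro: summable_sums\<close>)
    then show ?thesis by (rule holomorphic_on_imp_differentiable_at) auto
  qed
  then show ?thesis by (simp add: holomorphic_on_def field_differentiable_at_within)
qed

lemma holomorphic_ptheta:
  assumes "norm q < 1"
  shows "ptheta q holomorphic_on A"
  unfolding ptheta_def [abs_def] by (rule entire_power_series[OF summable_ptheta[OF assms]])

lemma holomorphic_papp:
  assumes "norm q < 1"
  shows "papp q holomorphic_on A"
proof -
  let ?a = "\<lambda>n. if n = 0 then 0 else q ^ (n * (n + 1)) / (1 + q ^ (2 * n))"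
  have s: "summable (\<lambda>n. ?a n * x ^ n)" for x
    using summable_papp[OF assms, of x] by (subst summable_Suc_iff [symmetric]) simp
  have "(\<Sum>n. ?a n * x ^ n) = papp q x" for x
    using suminf_split_head[OF s[of x]] unfolding papp_def by simp
  with entire_power_series[of ?a A] s show ?thesis by simp
qed

lemma holomorphic_comp_inverse:
  assumes "f holomorphic_on UNIV" "0 \<notin> A"
  shows "(\<lambda>x. f (1 / x)) holomorphic_on A"
proof -
  have "(f \<circ> (\<lambda>x. 1 / x)) holomorphic_on A"
    using assms by (intro holomorphic_on_compose holomorphic_on_subset[OF assms(1)] holomorphic_intros) auto
  then show ?thesis by (simp add: o_def)
qed

lemma holomorphic_btheta: "norm q < 1 \<Longrightarrow> btheta q holomorphic_on - {0}"
  unfolding btheta_def [abs_def]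
  by (intro holomorphic_intros holomorphic_ptheta holomorphic_comp_inverse) auto

lemma holomorphic_bapp: "norm q < 1 \<Longrightarrow> bapp q holomorphic_on - {0}"
  unfolding bapp_def [abs_def]
  by (intro holomorphic_intros holomorphic_papp holomorphic_comp_inverse) auto

lemma ptheta_step:
  assumes "norm q < 1"
  shows "q\<^sup>2 * x * ptheta q (q\<^sup>2 * x) = ptheta q x - 1"
proof -
  have "q\<^sup>2 * x * (q ^ (n * (n + 1)) * (q\<^sup>2 * x) ^ n) = q ^ (Suc n * (Suc n + 1)) * x ^ Suc n" for n
    by (simp add: power_mult_distrib power_add power2_eq_square algebra_simps flip: power_mult)
  then have "q\<^sup>2 * x * ptheta q (q\<^sup>2 * x) = (\<Sum>n. q ^ (Suc n * (Suc n + 1)) * x ^ Suc n)"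
    unfolding ptheta_def by (subst suminf_mult [OF summable_ptheta[OF assms], symmetric]) presburger
  also have "\<dots> = ptheta q x - 1"
    unfolding ptheta_def using suminf_split_head[OF summable_ptheta[OF assms, of x]] by simp
  finally show ?thesis .
qed

text \<open>Each half satisfies a recurrence with an extra constant. In the folded sum these
  constants cancel, which is the index shift of the bilateral series.\<close>

lemma btheta_quasi:
  assumes "q \<noteq> 0" "norm q < 1" "x \<noteq> 0"
  shows "btheta q (q\<^sup>2 * x) = btheta q x / (q\<^sup>2 * x)"
proof -
  have "ptheta q (q\<^sup>2 * x) = (ptheta q x - 1) / (q\<^sup>2 * x)"
    using ptheta_step[OF assms(2), of x] assms by (simp add: field_simps)
  moreover have "ptheta q (1 / (q\<^sup>2 * x)) = 1 + ptheta q (1 / x) / x"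
    using ptheta_step[OF assms(2), of "1 / (q\<^sup>2 * x)"] assms by (simp add: field_simps)
  ultimately show ?thesis
    by (simp add: btheta_def add_divide_distrib diff_divide_distrib)
qed

lemma btheta_inverse: "x \<noteq> 0 \<Longrightarrow> btheta q (1 / x) = x * btheta q x"
  by (simp add: btheta_def algebra_simps)

lemma bapp_inverse: "bapp q (1 / x) = bapp q x"
  by (simp add: bapp_def)

text \<open>Passing from x to q^2 x multiplies the n-th term by q^(2n), so adding both terms cancels
  the denominator 1 + q^(2n). The middle terms contribute 1/2 twice and restore the constant missing
  from the shifted series.\<close>

lemma bapp_step:
  assumes "q \<noteq> 0" "norm q < 1" "x \<noteq> 0"
  shows "bapp q (q\<^sup>2 * x) = btheta q x - bapp q x"
proof -
  have nz: "1 + q ^ (2 * Suc n) \<noteq> 0" for n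
    using norm_one_plus_ge[OF assms(2), of n] assms(2) by (metis norm_zero diff_gt_0_iff_gt leD)
  have "papp q (q\<^sup>2 * x) + papp q x = (\<Sum>n. q ^ (Suc n * (Suc n + 1)) * x ^ Suc n)"
    unfolding papp_def
  proof (subst suminf_add[OF summable_papp[OF assms(2)] summable_papp[OF assms(2)]],
      intro suminf_cong)
    fix n
    let ?w = "q ^ (Suc n * (Suc n + 1)) / (1 + q ^ (2 * Suc n))"
    have "?w * (q\<^sup>2 * x) ^ Suc n + ?w * x ^ Suc n = ?w * (1 + q ^ (2 * Suc n)) * x ^ Suc n"
      by (simp only: power_mult_distrib power_mult [symmetric] distrib_left distrib_right mult_ac) simp
    also have "\<dots> = q ^ (Suc n * (Suc n + 1)) * x ^ Suc n" using nz[of n] by simp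
    finally show "?w * (q\<^sup>2 * x) ^ Suc n + ?w * x ^ Suc n = q ^ (Suc n * (Suc n + 1)) * x ^ Suc n" .
  qed
  also have "\<dots> = ptheta q x - 1"
    unfolding ptheta_def using suminf_split_head[OF summable_ptheta[OF assms(2), of x]] by simp
  finally have 1: "papp q (q\<^sup>2 * x) + papp q x = ptheta q x - 1" .
  \<comment> \<open>Here the factor is 1 + q^(-2m) with m = n + 1; the leftover division by q^(2m)
    lowers the exponent m(m+1) to n(n+1).\<close>
  have "papp q (1 / (q\<^sup>2 * x)) + papp q (1 / x) = (\<Sum>n. q ^ (n * (n + 1)) * (1 / x) ^ n * (1 / x))"
    unfolding papp_def
  proof (subst suminf_add[OF summable_papp[OF assms(2)] summable_papp[OF assms(2)]],
      intro suminf_cong)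
    fix n
    let ?w = "q ^ (Suc n * (Suc n + 1)) / (1 + q ^ (2 * Suc n))"
    have "(1 / (q\<^sup>2 * x)) ^ Suc n + (1 / x) ^ Suc n
        = (1 + q ^ (2 * Suc n)) / q ^ (2 * Suc n) * (1 / x) ^ Suc n"
    proof -
      have "(1 / (q\<^sup>2 * x)) ^ Suc n = 1 / q ^ (2 * Suc n) * (1 / x) ^ Suc n"
        by (simp only: power_divide power_one power_mult_distrib power_mult [symmetric]) simp
      moreover have "(1 + q ^ (2 * Suc n)) / q ^ (2 * Suc n) = 1 / q ^ (2 * Suc n) + 1"
        using assms(1) by (simp add: add_divide_distrib)
      ultimately show ?thesis by (simp only: distrib_right mult_1_left)
    qed
    then have "?w * (1 / (q\<^sup>2 * x)) ^ Suc n + ?w * (1 / x) ^ Suc n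
        = ?w * ((1 + q ^ (2 * Suc n)) / q ^ (2 * Suc n) * (1 / x) ^ Suc n)"
      by (metis distrib_left)
    also have "\<dots> = q ^ (Suc n * (Suc n + 1)) / q ^ (2 * Suc n) * (1 / x) ^ Suc n"
      using nz[of n] by simp
    also have "q ^ (Suc n * (Suc n + 1)) / q ^ (2 * Suc n) = q ^ (n * (n + 1))"
    proof -
      have "Suc n * (Suc n + 1) = n * (n + 1) + 2 * Suc n" by simp
      then show ?thesis using assms(1) by (simp only: power_add) simp
    qed
    finally show "?w * (1 / (q\<^sup>2 * x)) ^ Suc n + ?w * (1 / x) ^ Suc n
        = q ^ (n * (n + 1)) * (1 / x) ^ n * (1 / x)" by simp
  qed
  also have "\<dots> = ptheta q (1 / x) / x"
    unfolding ptheta_def using suminf_mult2[OF summable_ptheta[OF assms(2)], of "1 / x" "1 / x"] by simp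
  finally have 2: "papp q (1 / (q\<^sup>2 * x)) + papp q (1 / x) = ptheta q (1 / x) / x" .
  have "papp q (q\<^sup>2 * x) = ptheta q x - 1 - papp q x"
    "papp q (1 / (q\<^sup>2 * x)) = ptheta q (1 / x) / x - papp q (1 / x)"
    using 1 2 by (metis add_diff_cancel_right')+
  then show ?thesis by (simp add: bapp_def btheta_def)
qed

section \<open>The Eulerian series\<close>

text \<open>Where no factor vanishes, the two infinite products are \<open>ftheta q x\<close>
  divided by (xq;q^2)_(n+1) (q/x;q^2)_(n+1), so the denominators of the series are absorbed.\<close>

definition eul_term :: "complex \<Rightarrow> complex \<Rightarrow> nat \<Rightarrow> complex" where
  "eul_term q x n = q ^ (n + 1) * qpoch (- q) q (2 * n) *
     (qpoch_inf (x * q ^ (2 * n + 3)) (q\<^sup>2) * qpoch_inf (q ^ (2 * n + 3) / x) (q\<^sup>2))"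

text \<open>The Eulerian series of \<open>S\<^sub>2(x;q)\<close>, multiplied by a theta function to clear its poles.\<close>

definition eul :: "complex \<Rightarrow> complex \<Rightarrow> complex" where
  "eul q x = (1 + x) * (\<Sum>n. eul_term q x n)"

definition ftheta :: "complex \<Rightarrow> complex \<Rightarrow> complex" where
  "ftheta q x = qpoch_inf (x * q) (q\<^sup>2) * qpoch_inf (q / x) (q\<^sup>2)"

text \<open>All products are bounded uniformly in \<open>n\<close> on the annulus 1/B <= |x| <= B,
  and the power of q leaves a geometric majorant.\<close>

lemma norm_eul_term_le:
  fixes q x :: complex
  assumes q: "norm q < 1" and x: "norm x \<le> B" "norm (1 / x) \<le> B"
  shows "norm (eul_term q x n)
    \<le> norm q ^ n * (exp (norm q / (1 - norm q)) * (exp (B / (1 - norm (q\<^sup>2))) * exp (B / (1 - norm (q\<^sup>2)))))"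
proof -
  note q2 = norm_power2_less_1[OF q]
  have aux: "norm (qpoch_inf (y * q ^ m) (q\<^sup>2)) \<le> exp (B / (1 - norm (q\<^sup>2)))" if "norm y \<le> B" for y m
  proof -
    have "norm (y * q ^ m) \<le> B * 1"
      unfolding norm_mult norm_power using that q order_trans[OF norm_ge_zero that]
      by (intro mult_mono power_le_one) auto
    then have "norm (y * q ^ m) / (1 - norm (q\<^sup>2)) \<le> B / (1 - norm (q\<^sup>2))"
      using q2 by (intro divide_right_mono) auto
    then show ?thesis using norm_qpoch_inf_le[OF q2, of "y * q ^ m"] by (meson exp_le_cancel_iff order_trans)
  qed
  have "norm q ^ (n + 1) \<le> norm q ^ n" using q by (intro power_decreasing) auto
  then show ?thesis
    unfolding eul_term_def norm_mult norm_power mult.assoc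
    using norm_qpoch_le[OF q, of "- q" "2 * n"] aux[OF x(1), of "2 * n + 3"] aux[OF x(2), of "2 * n + 3"]
    by (intro mult_mono mult_nonneg_nonneg) (auto simp: norm_power)
qed

lemma summable_eul_term:
  assumes "norm q < 1"
  shows "summable (eul_term q x)"
proof (rule summable_comparison_test')
  let ?B = "max (norm x) (norm (1 / x))"
  let ?C = "exp (norm q / (1 - norm q)) * (exp (?B / (1 - norm (q\<^sup>2))) * exp (?B / (1 - norm (q\<^sup>2))))"
  show "summable (\<lambda>n. norm q ^ n * ?C)" using assms by (intro summable_mult2 summable_geometric) auto
  show "norm (eul_term q x n) \<le> norm q ^ n * ?C" for n
    by (rule norm_eul_term_le[OF assms]) auto
qed

lemma holomorphic_eul:
  assumes q: "norm q < 1"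
  shows "eul q holomorphic_on - {0}"
proof -
  note q2 = norm_power2_less_1[OF q]
  have "(\<lambda>x. \<Sum>n. eul_term q x n) holomorphic_on - {0}"
  proof (rule suminf_holomorphic)
    show "(\<lambda>x. eul_term q x n) holomorphic_on - {0}" for n
      unfolding eul_term_def by (intro holomorphic_intros qpoch_inf_holomorphic_comp q2) auto
    fix x :: complex assume x: "x \<in> - {0}"
    let ?B = "max (2 * norm x) (2 / norm x)"
    let ?C = "exp (norm q / (1 - norm q)) * (exp (?B / (1 - norm (q\<^sup>2))) * exp (?B / (1 - norm (q\<^sup>2))))"
    show "\<exists>d h. 0 < d \<and> summable h \<and> (\<forall>n. \<forall>y\<in>ball x d \<inter> - {0}. norm (eul_term q y n) \<le> h n)"
    proof (intro exI conjI allI ballI)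
      show "0 < norm x / 2" using x by simp
      show "summable (\<lambda>n. norm q ^ n * ?C)" using q by (intro summable_mult2 summable_geometric) auto
      fix n y assume y: "y \<in> ball x (norm x / 2) \<inter> - {0}"
      then have d: "norm (x - y) < norm x / 2" by (simp add: dist_norm)
      have "norm y \<le> 2 * norm x"
        using norm_triangle_ineq2[of y x] d norm_ge_zero[of x] unfolding norm_minus_commute[of x y] by linarith
      moreover have "norm x / 2 \<le> norm y" using norm_triangle_ineq2[of x y] d by simp
      then have "norm (1 / y) \<le> 2 / norm x"
        using x y by (simp add: norm_divide field_simps)
      ultimately show "norm (eul_term q y n) \<le> norm q ^ n * ?C"
        by (intro norm_eul_term_le[OF q]) auto
    qed
  qed auto
  then show ?thesis unfolding eul_def [abs_def] by (intro holomorphic_intros)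
qed

lemma holomorphic_ftheta:
  assumes q: "norm q < 1"
  shows "ftheta q holomorphic_on - {0}"
  unfolding ftheta_def [abs_def]
  by (intro holomorphic_intros qpoch_inf_holomorphic_comp norm_power2_less_1[OF q]) auto

lemma ftheta_inverse: "ftheta q (1 / x) = ftheta q x"
  by (simp add: ftheta_def mult_ac)

lemma eul_inverse: "x \<noteq> 0 \<Longrightarrow> eul q (1 / x) = eul q x / x"
proof -
  assume "x \<noteq> 0"
  have "eul_term q (1 / x) n = eul_term q x n" for n by (simp add: eul_term_def mult_ac)
  then show ?thesis using \<open>x \<noteq> 0\<close> by (simp add: eul_def field_simps)
qed

lemma ftheta_quasi:
  assumes "q \<noteq> 0" "norm q < 1" "x \<noteq> 0"
  shows "ftheta q (q\<^sup>2 * x) = - ftheta q x / (q * x)"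
proof (cases "q * x = 1")
  case True
  have "x = 1 / q" using True assms by (simp add: field_simps)
  then have "q\<^sup>2 * x = q" "q / x = q\<^sup>2" "x * q = 1" using assms by (simp_all add: power2_eq_square)
  moreover have "qpoch_inf 1 (q\<^sup>2) = 0"
    by (rule qpoch_inf_eq_0[OF norm_power2_less_1[OF assms(2)], of _ 0]) simp
  ultimately show ?thesis using assms by (simp add: ftheta_def)
next
  case False
  note q2 = norm_power2_less_1[OF assms(2)]
  have 1: "qpoch_inf (x * q) (q\<^sup>2) = (1 - q * x) * qpoch_inf (q\<^sup>2 * x * q) (q\<^sup>2)"
    using qpoch_inf_step[OF q2, of "x * q"] by (simp add: mult_ac)
  have 2: "qpoch_inf (q / (q\<^sup>2 * x)) (q\<^sup>2) = (1 - 1 / (q * x)) * qpoch_inf (q / x) (q\<^sup>2)"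
    using qpoch_inf_step[OF q2, of "q / (q\<^sup>2 * x)"] assms by (simp add: power2_eq_square)
  have e: "1 - 1 / (q * x) = - ((1 - q * x) / (q * x))" using assms by (simp add: field_simps)
  show ?thesis unfolding ftheta_def 1 2 e by simp
qed

text \<open>The relation between the terms at \<open>x\<close> and \<open>q\<^sup>2 x\<close> telescopes.\<close>

lemma eul_step:
  assumes "q \<noteq> 0" "norm q < 1" "x \<noteq> 0"
  shows "eul q (q\<^sup>2 * x) = q * eul q x + q * ftheta q x"
proof -
  note q2 = norm_power2_less_1[OF assms(2)]
  \<comment> \<open>The telescoping certificate. Its value at 0 is \<open>ftheta q x\<close>,
    because 1 - xq completes the first product, and q^n makes it tend to 0.\<close>
  define g where "g n = q ^ n * qpoch (- q) q (2 * n) * ((1 - x * q) *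
     (qpoch_inf (x * q ^ (2 * n + 3)) (q\<^sup>2) * qpoch_inf (q ^ (2 * n + 1) / x) (q\<^sup>2)))" for n
  have key: "(1 + q\<^sup>2 * x) * eul_term q (q\<^sup>2 * x) n - q * (1 + x) * eul_term q x n = - q * (g (Suc n) - g n)" for n
  proof -
    define F where "F = qpoch_inf (x * q ^ (2 * n + 5)) (q\<^sup>2)"
    define G where "G = qpoch_inf (q ^ (2 * n + 3) / x) (q\<^sup>2)"
    define Y where "Y = q ^ n"
    define P where "P = qpoch (- q) q (2 * n)"
    have F: "qpoch_inf (x * q ^ (2 * n + 3)) (q\<^sup>2) = (1 - x * (q ^ 3 * Y\<^sup>2)) * F"
      using qpoch_inf_step[OF q2, of "x * q ^ (2 * n + 3)"]
      by (simp add: F_def Y_def power_add power_mult mult_ac numeral_eq_Suc power2_eq_square power_mult_distrib)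
    have G: "qpoch_inf (q ^ (2 * n + 1) / x) (q\<^sup>2) = (1 - q * Y\<^sup>2 / x) * G"
      using qpoch_inf_step[OF q2, of "q ^ (2 * n + 1) / x"]
      by (simp add: G_def Y_def power_add power_mult mult_ac numeral_eq_Suc power2_eq_square power_mult_distrib)
    have P: "qpoch (- q) q (2 * Suc n) = P * (1 + q * Y\<^sup>2) * (1 + q\<^sup>2 * Y\<^sup>2)"
      by (simp add: P_def Y_def qpoch_Suc power_add power_mult power2_eq_square power_mult_distrib mult_ac)
    have e1: "eul_term q (q\<^sup>2 * x) n = q * Y * P * (F * ((1 - q * Y\<^sup>2 / x) * G))"
    proof -
      have eqs: "q\<^sup>2 * x * q ^ (2 * n + 3) = x * q ^ (2 * n + 5)" "q ^ (2 * n + 3) / (q\<^sup>2 * x) = q ^ (2 * n + 1) / x"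
        using assms by (simp_all add: power_add numeral_eq_Suc)
      show ?thesis unfolding eul_term_def eqs F_def [symmetric] G by (simp add: Y_def P_def)
    qed
    have e2: "eul_term q x n = q * Y * P * ((1 - x * (q ^ 3 * Y\<^sup>2)) * F * G)"
      unfolding eul_term_def F G_def[symmetric] by (simp add: Y_def P_def)
    have g1: "g n = Y * P * ((1 - x * q) * ((1 - x * (q ^ 3 * Y\<^sup>2)) * F * ((1 - q * Y\<^sup>2 / x) * G)))"
      unfolding g_def F G by (simp add: Y_def P_def)
    have g2: "g (Suc n) = q * Y * (P * (1 + q * Y\<^sup>2) * (1 + q\<^sup>2 * Y\<^sup>2)) * ((1 - x * q) * (F * G))"
    proof -
      have eqs: "2 * Suc n + 3 = 2 * n + 5" "2 * Suc n + 1 = 2 * n + 3" by simp_all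
      show ?thesis unfolding g_def P eqs F_def [symmetric] G_def [symmetric] by (simp add: Y_def)
    qed
    \<comment> \<open>Writing Y^2 = z x removes the division by x and leaves a polynomial
      identity.\<close>
    define z where "z = Y\<^sup>2 / x"
    have z: "Y\<^sup>2 = z * x" "q * Y\<^sup>2 / x = q * z" using assms by (simp_all add: z_def)
    show ?thesis unfolding e1 e2 g1 g2 z(2) unfolding z(1) by algebra
  qed
  have g0: "g \<longlonglongrightarrow> 0"
  proof -
    have e: "(\<lambda>n. y * q ^ (2 * n + m)) \<longlonglongrightarrow> 0" if "m > 0" for m y
    proof -
      have "(\<lambda>n. y * q ^ m * (q\<^sup>2) ^ n) \<longlonglongrightarrow> 0"
        by (rule tendsto_mult_right_zero[OF LIMSEQ_power_zero[OF q2]])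
      moreover have "y * q ^ m * (q\<^sup>2) ^ n = y * q ^ (2 * n + m)" for n
        by (simp add: power_add mult_ac flip: power_mult)
      ultimately show ?thesis by simp
    qed
    have t: "(\<lambda>n. qpoch_inf (y * q ^ (2 * n + m)) (q\<^sup>2)) \<longlonglongrightarrow> 1" if "m > 0" for m y
      using isCont_tendsto_compose[OF isCont_qpoch_inf[OF q2] e[OF that]] by simp
    have p: "(\<lambda>n. qpoch (- q) q (2 * n)) \<longlonglongrightarrow> qpoch_inf (- q) q"
      by (rule filterlim_compose[OF qpoch_LIMSEQ[OF assms(2)]])
        (simp add: filterlim_at_top_mult_tendsto_pos mult_nat_left_at_top)
    have "g \<longlonglongrightarrow> 0 * qpoch_inf (- q) q * ((1 - x * q) * (1 * 1))"
      unfolding g_def [abs_def]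
      using t[of 1 "1 / x"] by (intro tendsto_intros t p LIMSEQ_power_zero assms) simp_all
    then show ?thesis by simp
  qed
  have "(\<lambda>n. - q * (g (Suc n) - g n)) sums (- q * (0 - g 0))"
    by (intro sums_mult telescope_sums g0)
  moreover have "(\<lambda>n. (1 + q\<^sup>2 * x) * eul_term q (q\<^sup>2 * x) n - q * (1 + x) * eul_term q x n) sums
      ((1 + q\<^sup>2 * x) * (\<Sum>n. eul_term q (q\<^sup>2 * x) n) - q * (1 + x) * (\<Sum>n. eul_term q x n))"
    by (intro sums_diff sums_mult summable_sums summable_eul_term assms)
  ultimately have "eul q (q\<^sup>2 * x) - q * eul q x = q * g 0"
    unfolding key using sums_unique2 by (fastforce simp: eul_def mult_ac)
  moreover have "g 0 = ftheta q x"
    using qpoch_inf_step[OF q2, of "x * q"]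
    by (simp add: g_def ftheta_def power2_eq_square power3_eq_cube mult_ac)
  ultimately show ?thesis by (simp add: algebra_simps)
qed

section \<open>Special values of the Eulerian series and the closed form of S_2\<close>

lemma qpoch_minus_q_split:
  assumes "norm q < 1"
  shows "qpoch_inf (- q) q = qpoch_inf (- q) (q\<^sup>2) * qpoch_inf (- (q\<^sup>2)) (q\<^sup>2)"
  using qpoch_inf_even_odd[OF assms, of "- q"] by (simp add: power2_eq_square)

text \<open>At the points \<open>q\<^sup>-\<^sup>2\<^sup>N\<^sup>-\<^sup>1\<close> the theta term of the functional equation vanishes, so the value at
  \<open>1/q\<close> can be computed in the limit \<open>N \<rightarrow> \<infinity>\<close>.\<close>

lemma eul_at_inverse_q:
  fixes q :: complex
  assumes "q \<noteq> 0" "norm q < 1"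
  shows "eul q (1 / q) = qpoch_inf (q\<^sup>2) (q\<^sup>2) / qpoch_inf q (q\<^sup>2) ^ 2"
proof -
  note q2 = norm_power2_less_1[OF assms(2)]
  \<comment> \<open>\<open>y N\<close> is 1/q moved N times by q^(-2). Up to the common factor 1 +
    q^(2N+1), \<open>a s N\<close> is the summand with index s + N at \<open>y N\<close>, including
    the weight q^N (1 + y N).\<close>
  define y where "y N = 1 / q ^ (2 * N + 1)" for N
  define a where "a s N = q ^ s * qpoch (- q) q (2 * (s + N)) *
      (qpoch_inf (q ^ (2 * s + 2)) (q\<^sup>2) * qpoch_inf (q ^ (4 * N + 2 * s + 4)) (q\<^sup>2))" for s N
  have y0: "y N \<noteq> 0" for N using assms by (simp add: y_def)
  have step: "eul q (y N) = q * eul q (y (Suc N))" for N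
  proof -
    have "ftheta q (y (Suc N)) = 0"
    proof -
      have "y (Suc N) * q * (q\<^sup>2) ^ Suc N = 1"
      proof -
        have "q * (q\<^sup>2) ^ Suc N = q ^ (2 * Suc N + 1)"
          unfolding power_mult [symmetric] by simp
        then show ?thesis using assms(1) by (simp only: y_def mult.assoc) simp
      qed
      from qpoch_inf_eq_0[OF q2 this] show ?thesis by (simp add: ftheta_def)
    qed
    moreover have "q\<^sup>2 * y (Suc N) = y N" using assms by (simp add: y_def power2_eq_square)
    ultimately show ?thesis using eul_step[OF assms y0[of "Suc N"]] by simp
  qed
  have iter: "eul q (1 / q) = q ^ N * eul q (y N)" for N
  proof (induction N)
    case 0
    then show ?case by (simp add: y_def)
  next
    case (Suc N)
    then show ?case using step[of N] by simp
  qed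
  have formula: "eul q (1 / q) = (1 + q ^ (2 * N + 1)) * (\<Sum>s. a s N)" for N
  proof -
    \<comment> \<open>For n < N the first infinite product contains a zero factor, at position N - n
      - 1, so the sum effectively starts at N.\<close>
    have z: "eul_term q (y N) n = 0" if "n < N" for n
    proof -
      have "y N * q ^ (2 * n + 3) * (q\<^sup>2) ^ (N - Suc n) = 1"
      proof -
        have "2 * n + 3 + 2 * (N - Suc n) = 2 * N + 1" using that by simp
        then have "q ^ (2 * n + 3) * (q\<^sup>2) ^ (N - Suc n) = q ^ (2 * N + 1)"
          by (metis power_add power_mult)
        then show ?thesis using assms by (simp add: y_def)
      qed
      from qpoch_inf_eq_0[OF q2 this] show ?thesis by (simp add: eul_term_def)
    qed
    have t: "q ^ N * (1 + y N) * eul_term q (y N) (s + N) = (1 + q ^ (2 * N + 1)) * a s N" for s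
    proof -
      have "q ^ (2 * (s + N) + 3) = q ^ (2 * s + 2) * q ^ (2 * N + 1)"
        "q ^ (2 * (s + N) + 3) * q ^ (2 * N + 1) = q ^ (4 * N + 2 * s + 4)"
        by (subst power_add [symmetric], rule arg_cong[where f = "\<lambda>m. q ^ m"], simp)+
      then have "y N * q ^ (2 * (s + N) + 3) = q ^ (2 * s + 2)" "q ^ (2 * (s + N) + 3) / y N = q ^ (4 * N + 2 * s + 4)"
        using assms(1) unfolding y_def by (simp_all del: power_Suc)
      moreover have "q ^ N * (1 + y N) * q ^ (s + N + 1) = (1 + q ^ (2 * N + 1)) * q ^ s"
      proof -
        have "q ^ N * (1 + y N) * q ^ (s + N + 1) = (1 + y N) * q ^ (2 * N + 1) * q ^ s"
        proof -
          have "q ^ N * q ^ (s + N + 1) = q ^ (2 * N + 1) * q ^ s"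
            unfolding power_add [symmetric] by (rule arg_cong[where f = "\<lambda>m. q ^ m"]) simp
          then show ?thesis by (metis mult.assoc mult.commute)
        qed
        also have "(1 + y N) * q ^ (2 * N + 1) = 1 + q ^ (2 * N + 1)"
          using assms by (simp add: y_def field_simps)
        finally show ?thesis .
      qed
      ultimately show ?thesis unfolding eul_term_def a_def by (metis (no_types, lifting) mult.assoc)
    qed
    have "eul q (1 / q) = q ^ N * (1 + y N) * (\<Sum>s. eul_term q (y N) (s + N))"
      using iter[of N] suminf_split_initial_segment[OF summable_eul_term[OF assms(2), of "y N"], of N] z
      by (simp add: eul_def)
    also have "\<dots> = (\<Sum>s. (1 + q ^ (2 * N + 1)) * a s N)"
      unfolding t [symmetric]
      by (intro suminf_mult [symmetric] summable_ignore_initial_segment summable_eul_term assms)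
    also have "\<dots> = (1 + q ^ (2 * N + 1)) * (\<Sum>s. a s N)"
    proof (rule suminf_mult)
      have "summable (\<lambda>s. (1 + q ^ (2 * N + 1)) * a s N)"
        unfolding t [symmetric]
        by (intro summable_mult summable_ignore_initial_segment summable_eul_term assms)
      moreover have "1 + q ^ (2 * N + 1) \<noteq> 0"
      proof
        assume "1 + q ^ (2 * N + 1) = 0"
        then have "norm (q ^ (2 * N + 1)) = 1" by (simp add: add_eq_0_iff)
        then show False using assms(2) power_decreasing[of 1 "2 * N + 1" "norm q"] by (simp add: norm_power del: power_Suc)
      qed
      ultimately show "summable (\<lambda>s. a s N)" by (simp add: summable_cmult_iff)
    qed
    finally show ?thesis .
  qed
  define b where "b s = q ^ s * qpoch_inf (- q) q * (qpoch_inf (q ^ (2 * s + 2)) (q\<^sup>2) * 1)" for s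
  \<comment> \<open>Tannery's theorem with a geometric majorant uniform in N; the product with
    argument q^(4N+2s+4) tends to 1.\<close>
  have "((\<lambda>N. \<Sum>s. a s N) \<longlongrightarrow> (\<Sum>s. b s)) sequentially"
  proof -
    let ?C = "exp (1 / (1 - norm q)) * (exp (1 / (1 - norm (q\<^sup>2))) * exp (1 / (1 - norm (q\<^sup>2))))"
    have le: "norm (qpoch_inf (q ^ m) (q\<^sup>2)) \<le> exp (1 / (1 - norm (q\<^sup>2)))" for m
    proof -
      have "norm (q ^ m) / (1 - norm (q\<^sup>2)) \<le> 1 / (1 - norm (q\<^sup>2))"
        using assms(2) q2 by (intro divide_right_mono) (auto simp: norm_power power_le_one)
      then show ?thesis using norm_qpoch_inf_le[OF q2, of "q ^ m"] by (meson exp_le_cancel_iff order_trans)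
    qed
    have le': "norm (qpoch (- q) q m) \<le> exp (1 / (1 - norm q))" for m
    proof -
      have "norm (- q) / (1 - norm q) \<le> 1 / (1 - norm q)"
        using assms(2) by (intro divide_right_mono) auto
      then show ?thesis using norm_qpoch_le[OF assms(2), of "- q" m] by (meson exp_le_cancel_iff order_trans)
    qed
    have "norm (a s N) \<le> norm q ^ s * ?C" for s N
      unfolding a_def norm_mult mult.assoc
      by (intro mult_mono le le' mult_nonneg_nonneg) (simp_all add: norm_power)
    moreover have "(\<lambda>N. a s N) \<longlonglongrightarrow> b s" for s
    proof -
      have sub: "filterlim (\<lambda>N. c * N + d) at_top sequentially" if "c > 0" for c d :: nat
        by (rule filterlim_at_top_mono[OF filterlim_ident]) (use that in \<open>auto intro!: trans_le_add1 eventually_sequentiallyI\<close>)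
      have 1: "(\<lambda>N. qpoch (- q) q (2 * (s + N))) \<longlonglongrightarrow> qpoch_inf (- q) q"
        using filterlim_compose[OF qpoch_LIMSEQ[OF assms(2), of "- q"] sub[of 2 "2 * s"]] by (simp add: algebra_simps)
      have "(\<lambda>N. q ^ (4 * N + 2 * s + 4)) \<longlonglongrightarrow> 0"
        using filterlim_compose[OF LIMSEQ_power_zero[OF assms(2)] sub[of 4 "2 * s + 4"]] by (simp add: algebra_simps)
      then have 2: "(\<lambda>N. qpoch_inf (q ^ (4 * N + 2 * s + 4)) (q\<^sup>2)) \<longlonglongrightarrow> 1"
        using isCont_tendsto_compose[OF isCont_qpoch_inf[OF q2]] by fastforce
      show ?thesis unfolding a_def b_def by (intro tendsto_intros 1 2)
    qed
    moreover have "summable (\<lambda>s. norm q ^ s * ?C)"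
      using assms(2) by (intro summable_mult2 summable_geometric) auto
    ultimately show ?thesis
      using tannerys_theorem[of a b sequentially "\<lambda>s. norm q ^ s * ?C"] by (simp add: always_eventually)
  qed
  moreover have "(\<lambda>N. q ^ (2 * N + 1)) \<longlonglongrightarrow> 0"
  proof -
    have "(\<lambda>N. q * (q\<^sup>2) ^ N) \<longlonglongrightarrow> 0" by (intro tendsto_mult_right_zero LIMSEQ_power_zero q2)
    then show ?thesis by (simp add: power_mult)
  qed
  ultimately have "(\<lambda>N. (1 + q ^ (2 * N + 1)) * (\<Sum>s. a s N)) \<longlonglongrightarrow> (1 + 0) * (\<Sum>s. b s)"
    by (intro tendsto_intros)
  then have "eul q (1 / q) = (\<Sum>s. b s)"
    unfolding formula [symmetric] by (simp add: LIMSEQ_const_iff)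
  \<comment> \<open>Since (q^(2s+2);q^2)_inf is (q^2;q^2)_inf divided by (q^2;q^2)_s, this is
    Euler's series in base q^2 at the point q.\<close>
  also have "(\<Sum>s. b s) = qpoch_inf (- q) q * qpoch_inf (q\<^sup>2) (q\<^sup>2) * (1 / qpoch_inf q (q\<^sup>2))"
  proof -
    have nz: "qpoch (q\<^sup>2) (q\<^sup>2) s \<noteq> 0" for s
      using qpoch_inf_shift[OF q2, of "q\<^sup>2" s] qpoch_inf_nonzero_small[OF q2 q2] by auto
    have "b s = qpoch_inf (- q) q * qpoch_inf (q\<^sup>2) (q\<^sup>2) * (q ^ s / qpoch (q\<^sup>2) (q\<^sup>2) s)" for s
    proof -
      have "q ^ (2 * s + 2) = q\<^sup>2 * (q\<^sup>2) ^ s" unfolding power_mult [symmetric] by (simp add: power2_eq_square)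
      then show ?thesis
        using qpoch_inf_shift[OF q2, of "q\<^sup>2" s] nz[of s] by (simp add: b_def)
    qed
    then have "b sums (qpoch_inf (- q) q * qpoch_inf (q\<^sup>2) (q\<^sup>2) * (1 / qpoch_inf q (q\<^sup>2)))"
      using sums_mult[OF euler_exp_sums[OF q2 assms(2)]] by presburger
    then show ?thesis by (simp add: sums_iff)
  qed
  also have "\<dots> = qpoch_inf (q\<^sup>2) (q\<^sup>2) / qpoch_inf q (q\<^sup>2) ^ 2"
  proof -
    have nz: "qpoch_inf q (q\<^sup>2) \<noteq> 0" by (rule qpoch_inf_nonzero_small[OF q2 assms(2)])
    have "qpoch_inf (- q) q = 1 / qpoch_inf q (q\<^sup>2)"
      using euler_odd_distinct[OF assms(2)] nz unfolding qpoch_minus_q_split[OF assms(2)]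
      by (simp add: field_simps)
    then show ?thesis by (simp add: power2_eq_square)
  qed
  finally show ?thesis .
qed

text \<open>At x = 1 both products equal (q;q^2)_inf divided by (q;q^2)_(n+1), and the factor 1 + x
  supplies the 2 in \<open>S2_one\<close>.\<close>

lemma eul_at_1:
  fixes q :: complex
  assumes "norm q < 1"
  shows "eul q 1 = qpoch_inf q (q\<^sup>2) ^ 2 * S2_one q"
proof -
  note q2 = norm_power2_less_1[OF assms]
  have nz: "qpoch q (q\<^sup>2) n \<noteq> 0" for n
    using qpoch_inf_shift[OF q2, of q n] qpoch_inf_nonzero_small[OF q2 assms] by auto
  have inner: "eul_term q 1 n = qpoch_inf q (q\<^sup>2) ^ 2 *
      (q ^ (n + 1) * qpoch (- q) q (2 * n) / qpoch q (q\<^sup>2) (n + 1) ^ 2)" for n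
  proof -
    have e: "q * (q\<^sup>2) ^ (n + 1) = q ^ (2 * n + 3)"
      by (simp add: power_add numeral_eq_Suc power_mult_distrib)
    show ?thesis
      unfolding qpoch_inf_shift[OF q2, of q "n + 1"] e eul_term_def using nz[of "n + 1"]
      by (simp add: power_mult_distrib power2_eq_square)
  qed
  have nzi: "qpoch_inf q (q\<^sup>2) ^ 2 \<noteq> 0" using qpoch_inf_nonzero_small[OF q2 assms] by simp
  have "summable (\<lambda>n. q ^ (n + 1) * qpoch (- q) q (2 * n) / qpoch q (q\<^sup>2) (n + 1) ^ 2)"
    using summable_eul_term[OF assms, of 1] unfolding inner [abs_def] by (subst (asm) summable_cmult_iff) (use nzi in auto)
  from suminf_mult[OF this, of "qpoch_inf q (q\<^sup>2) ^ 2"]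
  show ?thesis by (simp add: eul_def S2_one_def inner)
qed

text \<open>Uniqueness leaves one unknown constant for \<open>btheta\<close> and one for the
  combination \<open>k\<close>. Comparing values at q and at 1 eliminates both.\<close>

lemma S2_one_eq:
  fixes q :: complex
  assumes q: "q \<noteq> 0" "norm q < 1" and nz: "btheta q 1 \<noteq> 0"
  shows "2 * S2_one q - theta_J_bar 1 2 q ^ 3 / (2 * theta_J 1 4 q ^ 2) = - (2 * bapp q 1 / btheta q 1)"
proof -
  note q2 = norm_power2_less_1[OF q(2)]
  define A where "A = qpoch_inf q (q\<^sup>2)"
  define B where "B = qpoch_inf (- q) (q\<^sup>2)"
  define C where "C = qpoch_inf (q\<^sup>2) (q\<^sup>2)"
  define D where "D = qpoch_inf (- (q\<^sup>2)) (q\<^sup>2)"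
  have ABD: "A * (B * D) = 1" using euler_odd_distinct[OF q(2)] by (simp add: A_def B_def D_def)
  then have nz0: "A \<noteq> 0" "B \<noteq> 0" "D \<noteq> 0" by auto
  have C0: "C \<noteq> 0" unfolding C_def by (rule qpoch_inf_nonzero_small[OF q2 q2])
  have ann: "norm q ^ 3 < norm (1 :: complex)" "norm (1 :: complex) < 1 / norm q"
    "norm q ^ 3 < norm q" "norm q < 1 / norm q"
  proof -
    have "norm q ^ 3 < norm q ^ 1" using q by (intro power_strict_decreasing) auto
    then show "norm q ^ 3 < norm q" "norm q ^ 3 < norm (1 :: complex)" using q by auto
    show "norm (1 :: complex) < 1 / norm q" using q by simp
    then show "norm q < 1 / norm q" using less_trans[OF q(2)] by simp
  qed
  have m1: "qpoch_inf (- 1) (q\<^sup>2) = 2 * D"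
    using qpoch_inf_step[OF q2, of "- 1"] by (simp add: D_def)
  have theta_at_1: "qpoch_inf (- (1 * q)) (q\<^sup>2) * qpoch_inf (- (q / 1)) (q\<^sup>2) = B\<^sup>2"
    by (simp add: B_def power2_eq_square)
  have theta_at_q: "qpoch_inf (- (q * q)) (q\<^sup>2) * qpoch_inf (- (q / q)) (q\<^sup>2) = 2 * D\<^sup>2"
    using q m1 by (simp add: D_def power2_eq_square)
  have bq: "btheta q (1 / q) = q * btheta q q" by (rule btheta_inverse[OF q(1)])

  \<comment> \<open>The rescaling by 1/q gives \<open>btheta\<close> the multiplier and the
    inversion symmetry that \<open>theta_unique\<close> asks for.\<close>
  have "(\<lambda>x. btheta q (x / q)) holomorphic_on - {0}"
  proof -
    have "(btheta q \<circ> (\<lambda>x. x / q)) holomorphic_on - {0}"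
      using q(1) by (intro holomorphic_on_compose_gen[OF _ holomorphic_btheta[OF q(2)]] holomorphic_intros) auto
    then show ?thesis by (simp add: o_def)
  qed
  moreover have "btheta q (q\<^sup>2 * x / q) = btheta q (x / q) / (q * x)" if "x \<noteq> 0" for x
    using btheta_quasi[OF q, of "x / q"] that q by (simp add: power2_eq_square)
  moreover have "btheta q (1 / x / q) = btheta q (x / q)" if "x \<noteq> 0" for x
  proof -
    have "btheta q (1 / (x * q)) = x * q * btheta q (x * q)"
      by (rule btheta_inverse) (use that q in auto)
    moreover have "btheta q (x * q) = btheta q (x / q) / (q * x)"
      using btheta_quasi[OF q, of "x / q"] that q by (simp add: power2_eq_square mult.commute)
    ultimately show ?thesis using that q by simp
  qed
  ultimately obtain L where L: "\<And>x. norm q ^ 3 < norm x \<Longrightarrow> norm x < 1 / norm q \<Longrightarrow>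
      btheta q (x / q) = L * (qpoch_inf (- (x * q)) (q\<^sup>2) * qpoch_inf (- (q / x)) (q\<^sup>2))"
    using theta_unique[OF q, of "\<lambda>x. btheta q (x / q)"] by blast
  have L1: "q * btheta q q = L * B\<^sup>2"
    using L[OF ann(1,2)] bq theta_at_1 by simp
  have Lq: "btheta q 1 = L * (2 * D\<^sup>2)"
    using L[OF ann(3,4)] theta_at_q q by simp

  \<comment> \<open>The inhomogeneous terms of \<open>eul_step\<close> and \<open>bapp_step\<close>
    are both multiples of \<open>btheta\<close> times \<open>ftheta\<close> and cancel, so
    \<open>k\<close> has the multiplier 1/(qx).\<close>
  define k where "k x = btheta q x * eul q x + bapp q x * ftheta q x" for x
  have "k holomorphic_on - {0}"
    unfolding k_def [abs_def]
    by (intro holomorphic_intros holomorphic_btheta holomorphic_eul holomorphic_bapp holomorphic_ftheta q)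
  moreover have "k (q\<^sup>2 * x) = k x / (q * x)" if "x \<noteq> 0" for x
    unfolding k_def btheta_quasi[OF q that] bapp_step[OF q that] eul_step[OF q that] ftheta_quasi[OF q that]
    using that q by (simp add: field_simps power2_eq_square)
  moreover have "k (1 / x) = k x" if "x \<noteq> 0" for x
    unfolding k_def btheta_inverse[OF that] bapp_inverse eul_inverse[OF that] ftheta_inverse
    using that by simp
  ultimately obtain K where K: "\<And>x. norm q ^ 3 < norm x \<Longrightarrow> norm x < 1 / norm q \<Longrightarrow>
      k x = K * (qpoch_inf (- (x * q)) (q\<^sup>2) * qpoch_inf (- (q / x)) (q\<^sup>2))"
    using theta_unique[OF q, of k] by blast
  \<comment> \<open>At q the Appell part disappears together with \<open>ftheta\<close>, and
    inversion reduces \<open>eul q q\<close> to the known value at 1/q.\<close>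
  have ft: "ftheta q 1 = A\<^sup>2" "ftheta q q = 0"
    using qpoch_inf_eq_0[OF q2, of 1 0] q by (simp_all add: ftheta_def A_def power2_eq_square)
  have eq: "eul q q = q * (C / A\<^sup>2)"
    using eul_inverse[OF q(1), of q] eul_at_inverse_q[OF q] q(1) by (simp add: A_def C_def field_simps)
  have "k q = K * (2 * D\<^sup>2)" using K[OF ann(3,4)] theta_at_q by simp
  moreover have "k q = L * B\<^sup>2 * (C / A\<^sup>2)"
    unfolding k_def ft eq using L1 by (metis (no_types, lifting) add.right_neutral mult.assoc mult.commute mult_zero_right)
  moreover have "k 1 = K * B\<^sup>2" using K[OF ann(1,2)] theta_at_1 by simp
  moreover have "k 1 = btheta q 1 * (A\<^sup>2 * S2_one q) + bapp q 1 * A\<^sup>2"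
    unfolding k_def ft eul_at_1[OF q(2)] by (simp add: A_def)
  ultimately have main: "2 * D\<^sup>2 * (btheta q 1 * (A\<^sup>2 * S2_one q) + bapp q 1 * A\<^sup>2) = L * B\<^sup>2 * (C / A\<^sup>2) * B\<^sup>2"
    by (metis mult.commute mult.left_commute)
  have L0: "L \<noteq> 0" using nz Lq by auto

  have Jb: "theta_J_bar 1 2 q = B\<^sup>2 * C"
    using q by (simp add: theta_J_bar_def theta_j_def B_def C_def power2_eq_square)
  have J: "theta_J 1 4 q = A * (C * D)"
  proof -
    have "A = qpoch_inf q (q ^ 4) * qpoch_inf (q ^ 3) (q ^ 4)"
      using qpoch_inf_even_odd[OF q2, of q] by (simp add: A_def flip: power_Suc)
    moreover have "C * D = qpoch_inf (q ^ 4) (q ^ 4)"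
      using qpoch_inf_square[OF q2, of "q\<^sup>2"] by (simp add: C_def D_def)
    moreover have "q ^ 4 / q = q ^ 3" using q by (simp add: numeral_eq_Suc)
    ultimately show ?thesis by (simp add: theta_J_def theta_j_def)
  qed
  have "S2_one q + bapp q 1 / btheta q 1 = B ^ 4 * C / (4 * A ^ 4 * D ^ 4)" (is "?X = _")
  proof -
    define X where "X = ?X"
    have "2 * D\<^sup>2 * A\<^sup>2 * btheta q 1 * (S2_one q + bapp q 1 / btheta q 1) = L * B ^ 4 * C / A\<^sup>2"
    proof -
      have "btheta q 1 * (S2_one q + bapp q 1 / btheta q 1) = btheta q 1 * S2_one q + bapp q 1"
        using nz by (simp add: distrib_left)
      then have "2 * D\<^sup>2 * A\<^sup>2 * btheta q 1 * (S2_one q + bapp q 1 / btheta q 1)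
          = 2 * D\<^sup>2 * A\<^sup>2 * (btheta q 1 * S2_one q + bapp q 1)"
        by (simp only: mult.assoc)
      also have "\<dots> = 2 * D\<^sup>2 * (btheta q 1 * (A\<^sup>2 * S2_one q) + bapp q 1 * A\<^sup>2)"
        by (simp add: algebra_simps)
      finally have "2 * D\<^sup>2 * A\<^sup>2 * btheta q 1 * (S2_one q + bapp q 1 / btheta q 1)
          = 2 * D\<^sup>2 * (btheta q 1 * (A\<^sup>2 * S2_one q) + bapp q 1 * A\<^sup>2)" .
      then show ?thesis unfolding main by (simp add: numeral_eq_Suc)
    qed
    then have "2 * D\<^sup>2 * A\<^sup>2 * btheta q 1 * X = L * B ^ 4 * C / A\<^sup>2"
      by (simp only: X_def)
    then have "2 * D\<^sup>2 * A\<^sup>2 * (L * (2 * D\<^sup>2)) * X = L * B ^ 4 * C / A\<^sup>2"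
      by (simp only: Lq)
    then have "X = B ^ 4 * C / (4 * A ^ 4 * D ^ 4)" using L0 nz0 by (simp add: field_simps numeral_eq_Suc)
    then show ?thesis by (simp add: X_def)
  qed
  \<comment> \<open>Euler's relation A B D = 1 now trades 1/(A^2 D^2) for B^2, producing the sixth
    power of B in the theta quotient.\<close>
  also have "\<dots> = B ^ 4 * C / (4 * A\<^sup>2 * D\<^sup>2) * (1 / (A\<^sup>2 * D\<^sup>2))"
    by (simp add: numeral_eq_Suc)
  also have "1 / (A\<^sup>2 * D\<^sup>2) = B\<^sup>2"
  proof -
    have "B\<^sup>2 * (A\<^sup>2 * D\<^sup>2) = (A * (B * D))\<^sup>2" by (simp add: power_mult_distrib)
    then show ?thesis unfolding ABD using nz0 by (simp add: field_simps)
  qed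
  also have "B ^ 4 * C / (4 * A\<^sup>2 * D\<^sup>2) * B\<^sup>2 = B ^ 6 * C / (4 * A\<^sup>2 * D\<^sup>2)"
    by (simp add: numeral_eq_Suc)
  also have "\<dots> = theta_J_bar 1 2 q ^ 3 / (2 * theta_J 1 4 q ^ 2) / 2"
    unfolding Jb J using nz0 C0 by (simp add: field_simps numeral_eq_Suc)
  finally have "2 * (S2_one q + bapp q 1 / btheta q 1)
      = theta_J_bar 1 2 q ^ 3 / (2 * theta_J 1 4 q ^ 2)" by simp
  then show ?thesis by (simp add: distrib_left algebra_simps)
qed

section \<open>The finite sum at a root of unity\<close>

text \<open>At x = 1 these are the summands in the theorem; the free x makes a functional equation
  under x -> q^2 x possible.\<close>

definition dual_term :: "complex \<Rightarrow> complex \<Rightarrow> nat \<Rightarrow> complex" where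
  "dual_term q x n = q ^ (2 * n + 1) * (qpoch (x * q) (q\<^sup>2) n * qpoch (q / x) (q\<^sup>2) n)
     / qpoch (- q) q (2 * n + 1)"

text \<open>Continuing the telescoping of \<open>eul_step\<close> to negative indices turns its terms into these.\<close>

lemma dual_term_step:
  fixes q x :: complex
  assumes q: "q \<noteq> 0" "\<And>i. q ^ i \<noteq> - 1" and x: "x \<noteq> 0"
  shows "(1 + x * q\<^sup>2) * (\<Sum>n<N. dual_term q (x * q\<^sup>2) n) + x * q\<^sup>2 * ((1 + x) * (\<Sum>n<N. dual_term q x n))
    = 2 * x * q\<^sup>2 - x * q\<^sup>2 * (1 + q ^ (2 * N)) *
        (qpoch (x * q) (q\<^sup>2) N * qpoch (1 / (x * q)) (q\<^sup>2) N) / qpoch (- q) q (2 * N)"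
proof -
  \<comment> \<open>The telescoping certificate: \<open>b 0\<close> is the main term 2 x q^2 and
    \<open>b N\<close> the boundary term.\<close>
  define b where "b N = x * q\<^sup>2 * (1 + q ^ (2 * N)) *
        (qpoch (x * q) (q\<^sup>2) N * qpoch (1 / (x * q)) (q\<^sup>2) N) / qpoch (- q) q (2 * N)" for N
  have nz: "1 + q ^ i \<noteq> 0" for i using q(2)[of i] by (metis add_eq_0_iff)
  have nzP: "qpoch (- q) q n \<noteq> 0" for n
    using nz[of "Suc _"] by (simp add: qpoch_def)
  have q1: "1 + q \<noteq> 0" using nz[of 1] by simp
  have key: "(1 + x * q\<^sup>2) * dual_term q (x * q\<^sup>2) n + x * q\<^sup>2 * ((1 + x) * dual_term q x n) = b n - b (Suc n)" for n
  \<comment> \<open>The common product \<open>M\<close> arises by taking the first factor off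
    nonempty products, so the first index is checked separately.\<close>
  proof (cases n)
    case 0
    have q2: "1 + q\<^sup>2 \<noteq> 0" using nz[of 2] .
    have d: "dual_term q y 0 = q / (1 + q)" for y by (simp add: dual_term_def qpoch_def)
    have b0: "b 0 = 2 * x * q\<^sup>2" by (simp add: b_def)
    have "b 1 = x * q\<^sup>2 * (1 + q\<^sup>2) * ((1 - x * q) * (1 - 1 / (x * q))) / ((1 + q) * (1 + q\<^sup>2))"
      by (simp add: b_def qpoch_def numeral_2_eq_2)
    also have "\<dots> = x * q\<^sup>2 * ((1 - x * q) * (1 - 1 / (x * q))) / (1 + q)"
      using q1 q2 by (simp add: divide_simps)
    also have "\<dots> = q * ((1 - x * q) * (x * q - 1)) / (1 + q)"
    proof -
      have "x * q\<^sup>2 * (1 - 1 / (x * q)) = q * (x * q - 1)"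
        using x q by (simp add: field_simps power2_eq_square)
      then show ?thesis by (metis mult.left_commute)
    qed
    finally have b1: "b (Suc 0) = q * ((1 - x * q) * (x * q - 1)) / (1 + q)" by simp
    show ?thesis unfolding 0 d b0 b1 using q1 by (simp add: divide_simps) algebra
  next
    case (Suc m)
    define M where "M = qpoch (x * q ^ 3) (q\<^sup>2) m * qpoch (q / x) (q\<^sup>2) m"
    define Y where "Y = q ^ (2 * m)"
    define P where "P = qpoch (- q) q (2 * m + 2)"
    have Ym: "(q\<^sup>2) ^ m = Y" by (simp add: Y_def power_mult)
    have YSm: "x * q * (q\<^sup>2) ^ Suc m = x * q ^ 3 * Y" "1 / (x * q) * (q\<^sup>2) ^ Suc m = q * Y / x"
      unfolding power_Suc Ym using q x by (simp_all add: power2_eq_square power3_eq_cube)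
    have front: "qpoch y Q (Suc m) = (1 - y) * qpoch (y * Q) Q m" for y Q
      using qpoch_shift[of y Q 1 m] by (simp add: qpoch_def)
    have e1: "qpoch (x * q) (q\<^sup>2) (Suc m) = (1 - x * q) * qpoch (x * q ^ 3) (q\<^sup>2) m"
      unfolding front by (simp add: power3_eq_cube power2_eq_square mult_ac)
    have e2: "qpoch (1 / (x * q)) (q\<^sup>2) (Suc m) = (1 - 1 / (x * q)) * qpoch (q / x) (q\<^sup>2) m"
      unfolding front using q by (simp add: power2_eq_square)
    have e3: "qpoch (q / x) (q\<^sup>2) (Suc m) = qpoch (q / x) (q\<^sup>2) m * (1 - q * Y / x)"
      by (simp add: qpoch_Suc Y_def power_mult)
    have e4: "qpoch (x * q ^ 3) (q\<^sup>2) (Suc m) = qpoch (x * q ^ 3) (q\<^sup>2) m * (1 - x * q ^ 3 * Y)"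
      by (simp add: qpoch_Suc Y_def power_mult)
    have e5: "qpoch (x * q) (q\<^sup>2) (Suc (Suc m)) = (1 - x * q) * (qpoch (x * q ^ 3) (q\<^sup>2) m * (1 - x * q ^ 3 * Y))"
      unfolding qpoch_Suc[of _ _ "Suc m"] e1 YSm by simp
    have e6: "qpoch (1 / (x * q)) (q\<^sup>2) (Suc (Suc m)) = (1 - 1 / (x * q)) * (qpoch (q / x) (q\<^sup>2) m * (1 - q * Y / x))"
      unfolding qpoch_Suc[of _ _ "Suc m"] e2 YSm by simp
    have p1: "qpoch (- q) q (2 * Suc m + 1) = P * (1 + q ^ 3 * Y)"
      by (simp add: P_def qpoch_Suc Y_def power_add numeral_eq_Suc mult_ac)
    have p2: "qpoch (- q) q (2 * Suc (Suc m)) = P * (1 + q ^ 3 * Y) * (1 + q ^ 4 * Y)"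
      by (simp add: P_def qpoch_Suc Y_def power_add numeral_eq_Suc mult_ac)
    have p0: "qpoch (- q) q (2 * Suc m) = P" by (simp add: P_def)
    have nzs: "P \<noteq> 0" "1 + q ^ 3 * Y \<noteq> 0" "1 + q ^ 4 * Y \<noteq> 0"
      using nzP[of "2 * m + 2"] nz[of "3 + 2 * m"] nz[of "4 + 2 * m"] by (simp_all add: P_def Y_def power_add)
    have inv: "1 - 1 / (x * q) = (x * q - 1) / (x * q)" using x q by (simp add: field_simps)
    define z where "z = Y / x"
    have z: "Y = z * x" "q * Y / x = q * z" using x by (simp_all add: z_def)
    have d1: "dual_term q x (Suc m) = q ^ 3 * Y * ((1 - x * q) * (1 - q * z)) * M / (P * (1 + q ^ 3 * Y))"
      unfolding dual_term_def e1 e3 p1 z(2) M_def by (simp add: Y_def power_add numeral_eq_Suc mult_ac)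
    have d2: "dual_term q (x * q\<^sup>2) (Suc m)
        = q ^ 3 * Y * ((1 - x * q ^ 3 * Y) * ((x * q - 1) / (x * q))) * M / (P * (1 + q ^ 3 * Y))"
    proof -
      have eqs: "x * q\<^sup>2 * q = x * q ^ 3" "q / (x * q\<^sup>2) = 1 / (x * q)"
        using q by (simp_all add: power3_eq_cube power2_eq_square)
      show ?thesis unfolding dual_term_def eqs e4 e2 p1 inv M_def
        by (simp add: Y_def power_add numeral_eq_Suc mult_ac)
    qed
    have b1: "b (Suc m) = x * q\<^sup>2 * (1 + q\<^sup>2 * Y) * ((1 - x * q) * ((x * q - 1) / (x * q))) * M / P"
      unfolding b_def e1 e2 p0 inv M_def by (simp add: Y_def power_add power2_eq_square mult_ac)
    have b2: "b (Suc (Suc m)) = x * q\<^sup>2 * (1 + q ^ 4 * Y) *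
        ((1 - x * q) * (1 - x * q ^ 3 * Y) * ((x * q - 1) / (x * q)) * (1 - q * z)) * M / (P * (1 + q ^ 3 * Y) * (1 + q ^ 4 * Y))"
      unfolding b_def e5 e6 p2 inv z(2) M_def
      by (simp add: Y_def power_add numeral_eq_Suc mult_ac)
    have b1': "b (Suc m) = - (q * (1 + q\<^sup>2 * Y) * (1 + q ^ 3 * Y) * (1 - x * q) ^ 2) * M / (P * (1 + q ^ 3 * Y))"
      unfolding b1 using x q(1) nzs by (simp add: divide_simps) algebra
    have b2': "b (Suc (Suc m)) = - (q * (1 - x * q) ^ 2 * (1 - x * q ^ 3 * Y) * (1 - q * z)) * M / (P * (1 + q ^ 3 * Y))"
      unfolding b2 using x q(1) nzs by (simp add: divide_simps) algebra
    have d2': "dual_term q (x * q\<^sup>2) (Suc m) = - (q\<^sup>2 * z * (1 - x * q ^ 3 * Y) * (1 - x * q)) * M / (P * (1 + q ^ 3 * Y))"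
      unfolding d2 z(1) using x q(1) by (simp add: divide_simps) algebra
    show ?thesis unfolding Suc d1 d2' b1' b2'
      by (simp only: times_divide_eq_right diff_divide_distrib [symmetric] add_divide_distrib [symmetric])
        (rule arg_cong[where f = "\<lambda>y. y / (P * (1 + q ^ 3 * Y))"], unfold z(1), algebra)
  qed
  have "(1 + x * q\<^sup>2) * (\<Sum>n<N. dual_term q (x * q\<^sup>2) n) + x * q\<^sup>2 * ((1 + x) * (\<Sum>n<N. dual_term q x n)) = b 0 - b N"
    by (simp only: sum_distrib_left sum.distrib [symmetric] key sum_lessThan_telescope')
  then show ?thesis by (simp add: b_def)
qed

text \<open>Along the orbit x = z^(2i) the weighted sums \<open>H i\<close> obey a first-order
  recurrence. After an odd number of steps the orbit closes with a sign change, which determines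
  \<open>H 0\<close>.\<close>

lemma sum_dual_term_root_of_unity:
  fixes z :: complex
  assumes z: "z ^ (2 * k + 1) = 1"
  shows "2 * (\<Sum>n<2 * k + 1. dual_term z 1 n) = (\<Sum>i<2 * k + 1. (- 1) ^ i / z ^ (i * (i + 1)))"
proof -
  let ?p = "2 * k + 1"
  have z0: "z \<noteq> 0" using z by (metis power_0_left one_neq_zero Suc_eq_plus1 nat.distinct(1))
  \<comment> \<open>Raising to the odd power 2k + 1 would give both -1 and 1.\<close>
  have zm: "z ^ i \<noteq> - 1" for i
  proof
    assume "z ^ i = - 1"
    then have "(z ^ i) ^ ?p = - 1" by simp
    moreover have "(z ^ i) ^ ?p = 1" using z by (metis mult.commute power_mult power_one)
    ultimately show False by simp
  qed
  define H where "H i = (1 + z ^ (2 * i)) * (\<Sum>n<?p. dual_term z (z ^ (2 * i)) n)" for i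
  have step: "H (Suc i) = z ^ (2 * i + 2) * (2 - H i)" for i
  proof -
    let ?x = "z ^ (2 * i)"
    have "qpoch (?x * z) (z\<^sup>2) ?p = 0"
    proof -
      \<comment> \<open>Modulo 2k + 1 one has 2k = -1, so j = k(2i + 1) solves 2i + 1 + 2j = 0. The
        j-th factor vanishes, which kills the boundary term of
        \<open>dual_term_step\<close>.\<close>
      define j where "j = (k + 2 * k * i) mod ?p"
      have "(2 * i + 1 + 2 * j) mod ?p = (2 * i + 1 + 2 * (k + 2 * k * i)) mod ?p"
        unfolding j_def by (metis mod_add_right_eq mod_mult_right_eq)
      also have "2 * i + 1 + 2 * (k + 2 * k * i) = ?p * (2 * i + 1)" by (simp add: algebra_simps)
      finally have "?p dvd 2 * i + 1 + 2 * j" by (simp only: dvd_eq_mod_eq_0 mod_mult_self1_is_0)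
      then obtain c where "2 * i + 1 + 2 * j = ?p * c" by (rule dvdE)
      then have "?x * z * (z\<^sup>2) ^ j = 1"
        using z by (metis power_add power_mult power_one power_one_right)
      moreover have "j < ?p" by (simp add: j_def)
      ultimately show ?thesis unfolding qpoch_def
        by (intro prod_zero bexI[of _ j]) (simp_all del: prod.lessThan_Suc)
    qed
    then have "(1 + ?x * z\<^sup>2) * (\<Sum>n<?p. dual_term z (?x * z\<^sup>2) n)
        + ?x * z\<^sup>2 * ((1 + ?x) * (\<Sum>n<?p. dual_term z ?x n)) = 2 * ?x * z\<^sup>2"
      using dual_term_step[of z ?x ?p] z0 zm by simp
    moreover have "?x * z\<^sup>2 = z ^ (2 * Suc i)" by (simp add: power2_eq_square)
    moreover have "z ^ (2 * i + 2) = z ^ (2 * Suc i)" by simp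
    ultimately show ?thesis
      unfolding H_def by (simp only: mult.assoc) (simp only: right_diff_distrib mult_2_right mult_2 distrib_left eq_diff_eq)
  qed
  \<comment> \<open>The weights (-1)^n / z^(n(n+1)) act as a summation factor that makes the
    recurrence telescope.\<close>
  have iter: "(- 1) ^ n * H n / z ^ (n * (n + 1)) = H 0 - 2 * (\<Sum>i<n. (- 1) ^ i / z ^ (i * (i + 1)))" for n
  proof (induction n)
    case (Suc n)
    have e: "Suc n * (Suc n + 1) = n * (n + 1) + (2 * n + 2)" by simp
    have "(- 1) ^ Suc n * H (Suc n) / z ^ (Suc n * (Suc n + 1))
        = (- 1) ^ Suc n * (2 - H n) / z ^ (n * (n + 1))"
      unfolding step e power_add[of z "n * (n + 1)"] using z0 by simp
    also have "\<dots> = (- 1) ^ n * H n / z ^ (n * (n + 1)) - 2 * ((- 1) ^ n / z ^ (n * (n + 1)))"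
      by (simp add: algebra_simps diff_divide_distrib add_divide_distrib)
    finally show ?case unfolding Suc.IH by (simp add: algebra_simps)
  qed simp
  have "H ?p = H 0"
  proof -
    have "z ^ (2 * ?p) = z ^ (2 * 0)" using z by (simp only: mult.commute[of 2] power_mult) simp
    then show ?thesis unfolding H_def by (simp only:)
  qed
  moreover have "z ^ (?p * (?p + 1)) = 1" using z by (simp only: power_mult power_one)
  ultimately have "- H 0 = H 0 - 2 * (\<Sum>i<?p. (- 1) ^ i / z ^ (i * (i + 1)))"
    using iter[of ?p] by simp
  moreover have "y = s" if "- y = y - 2 * s" for y s :: complex
    using that by (simp add: field_simps)
  ultimately have "H 0 = (\<Sum>i<?p. (- 1) ^ i / z ^ (i * (i + 1)))" by blast
  then show ?thesis by (simp add: H_def)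
qed

text \<open>For n > k the product contains the factor 1 - z^(2k+1) = 0, so the sum over a full
  period stops at k.\<close>

lemma sum_dual_term_truncate:
  fixes z :: complex
  assumes z: "z ^ (2 * k + 1) = 1"
  shows "(\<Sum>n=0..k. qpoch z (z\<^sup>2) n ^ 2 * z ^ (2 * n + 1) / qpoch (- z) z (2 * n + 1))
    = (\<Sum>n<2 * k + 1. dual_term z 1 n)"
proof (rule sum.mono_neutral_cong_left)
  show "\<forall>n\<in>{..<2 * k + 1} - {0..k}. dual_term z 1 n = 0"
  proof
    fix n assume "n \<in> {..<2 * k + 1} - {0..k}"
    then have "k < n" by auto
    moreover have "z * (z\<^sup>2) ^ k = 1" using z by (simp flip: power_mult)
    ultimately have "qpoch z (z\<^sup>2) n = 0" by (auto simp: qpoch_def)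
    then show "dual_term z 1 n = 0" by (simp add: dual_term_def)
  qed
qed (auto simp: dual_term_def power2_eq_square mult_ac)

text \<open>Quasi-periodicity refers all theta values to x = 1, so the alternating iteration of
  \<open>bapp_step\<close> telescopes; oddness of \<open>p\<close> turns the difference of end
  values into a sum.\<close>

lemma bapp_iterate:
  fixes q :: complex
  assumes q: "q \<noteq> 0" "norm q < 1" and p: "odd p"
  shows "bapp q (q ^ (2 * p)) + bapp q 1 = btheta q 1 * (\<Sum>i<p. (- 1) ^ i / q ^ (i * (i + 1)))"
proof -
  have th: "btheta q (q ^ (2 * n)) = btheta q 1 / q ^ (n * (n + 1))" for n
  proof (induction n)
    case (Suc n)
    have e: "Suc n * (Suc n + 1) = n * (n + 1) + (2 + 2 * n)" by simp
    have "btheta q (q ^ (2 * Suc n)) = btheta q (q\<^sup>2 * q ^ (2 * n))"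
      by (simp add: power2_eq_square mult_ac)
    also have "\<dots> = btheta q (q ^ (2 * n)) / (q\<^sup>2 * q ^ (2 * n))"
      using btheta_quasi[OF q] q(1) by simp
    finally show ?case unfolding Suc.IH e power_add by simp
  qed simp
  have "(- 1) ^ n * bapp q (q ^ (2 * n)) = bapp q 1 - btheta q 1 * (\<Sum>i<n. (- 1) ^ i / q ^ (i * (i + 1)))" for n
  proof (induction n)
    case (Suc n)
    have "bapp q (q ^ (2 * Suc n)) = bapp q (q\<^sup>2 * q ^ (2 * n))"
      by (simp add: power2_eq_square mult_ac)
    also have "\<dots> = btheta q 1 / q ^ (n * (n + 1)) - bapp q (q ^ (2 * n))"
      using bapp_step[OF q] q(1) by (simp add: th)
    finally have E: "bapp q (q ^ (2 * Suc n)) = btheta q 1 / q ^ (n * (n + 1)) - bapp q (q ^ (2 * n))" .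
    have "(- 1) ^ Suc n * bapp q (q ^ (2 * Suc n))
        = (- 1) ^ n * bapp q (q ^ (2 * n)) - btheta q 1 * ((- 1) ^ n / q ^ (n * (n + 1)))"
      unfolding E by (simp add: algebra_simps)
    then show ?case unfolding Suc.IH by (simp add: algebra_simps)
  qed simp
  from this[of p] show ?thesis using p by (simp add: algebra_simps)
qed

section \<open>Radial growth\<close>

lemma sum_periodic_shift:
  fixes f :: "nat \<Rightarrow> 'a :: ab_group_add"
  assumes "\<And>n. f (n + p) = f n"
  shows "(\<Sum>d<p. f (n + d)) = (\<Sum>d<p. f d)"
proof (induction n)
  case (Suc n)
  have "(\<Sum>d<Suc p. f (n + d)) = f n + (\<Sum>d<p. f (Suc n + d))"
    by (subst sum.lessThan_Suc_shift) simp
  moreover have "(\<Sum>d<Suc p. f (n + d)) = (\<Sum>d<p. f (n + d)) + f n"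
    using assms[of n] by simp
  ultimately show ?case using Suc.IH by (simp add: add.commute)
qed simp

text \<open>Multiplied by the sum of the reciprocals, the Gauss sum gives 2k + 1: after the
  substitution m = n + d, orthogonality of characters leaves only d = 0.\<close>

lemma gauss_sum_nonzero:
  fixes z :: complex
  assumes z: "primitive_root_of_unity (2 * k + 1) z"
  shows "(\<Sum>n<2 * k + 1. z ^ (n * (n + 1))) \<noteq> 0"
proof -
  let ?p = "2 * k + 1"
  let ?f = "\<lambda>n. z ^ (n * (n + 1))"
  have zp: "z ^ ?p = 1" and prim: "\<And>m. 0 < m \<Longrightarrow> m < ?p \<Longrightarrow> z ^ m \<noteq> 1"
    using z by (auto simp: primitive_root_of_unity_def)
  have z0: "z \<noteq> 0" using zp by (metis power_0_left one_neq_zero Suc_eq_plus1 nat.distinct(1))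
  have per: "?f (n + ?p) = ?f n" for n
  proof -
    have "(n + ?p) * (n + ?p + 1) = n * (n + 1) + ?p * (2 * n + ?p + 1)" by (simp add: algebra_simps)
    moreover have "z ^ (?p * (2 * n + ?p + 1)) = 1" unfolding power_mult[of z ?p] zp by simp
    ultimately show ?thesis by (metis power_add mult_1_right)
  qed
  have inner: "(\<Sum>n<?p. (z ^ (2 * d)) ^ n) = (if d = 0 then of_nat ?p else 0)" if "d < ?p" for d
  proof (cases "d = 0")
    case False
    \<comment> \<open>As the order is odd, 2d is not a multiple of it; reducing 2d once brings it
      into the range covered by primitivity.\<close>
    have "z ^ (2 * d) \<noteq> 1"
    proof (cases "2 * d < ?p")
      case True
      then show ?thesis using prim[of "2 * d"] False by simp
    next
      case False
      then have "0 < 2 * d - ?p" "2 * d - ?p < ?p" using that by presburger+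
      moreover have "z ^ (2 * d) = z ^ (2 * d - ?p) * z ^ ?p"
        using False by (subst power_add [symmetric]) simp
      ultimately show ?thesis using prim[of "2 * d - ?p"] zp by simp
    qed
    moreover have "(z ^ (2 * d)) ^ ?p = 1"
      using zp by (metis mult.commute power_mult power_one)
    ultimately show ?thesis using False by (simp only: sum_gp_strict if_False) simp
  qed simp
  have "(\<Sum>m<?p. ?f m) * (\<Sum>n<?p. 1 / ?f n) = (\<Sum>n<?p. \<Sum>d<?p. ?f (n + d) / ?f n)"
    by (simp only: sum_distrib_left times_divide_eq_right mult_1_right sum_divide_distrib [symmetric]
        sum_periodic_shift[of ?f, OF per])
  also have "\<dots> = (\<Sum>n<?p. \<Sum>d<?p. ?f d * (z ^ (2 * d)) ^ n)"
  proof (intro sum.cong refl)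
    fix n d :: nat
    have "(n + d) * (n + d + 1) = d * (d + 1) + 2 * d * n + n * (n + 1)" by (simp add: algebra_simps)
    then show "?f (n + d) / ?f n = ?f d * (z ^ (2 * d)) ^ n"
      using z0 by (simp only: power_add power_mult [symmetric]) simp
  qed
  also have "\<dots> = (\<Sum>d<?p. ?f d * (\<Sum>n<?p. (z ^ (2 * d)) ^ n))"
    by (subst sum.swap) (simp only: sum_distrib_left)
  also have "\<dots> = (\<Sum>d<?p. if d = 0 then of_nat ?p else 0)"
    by (intro sum.cong refl) (subst inner, auto)
  also have "\<dots> = of_nat ?p" by (simp add: sum.delta)
  finally show ?thesis by (metis mult_zero_left of_nat_eq_0_iff add_is_0 one_neq_zero)
qed

text \<open>Mean zero allows subtracting \<open>b (m * p)\<close> throughout the m-th block.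
  Monotonicity bounds the block by a difference that telescopes to \<open>b 0\<close>, however
  slowly \<open>b\<close> decays.\<close>

lemma norm_suminf_periodic_decseq_le:
  fixes v :: "nat \<Rightarrow> complex" and b :: "nat \<Rightarrow> real"
  assumes p: "0 < p" and per: "\<And>n. v (n + p) = v n" and mean: "(\<Sum>c<p. v c) = 0"
    and dec: "decseq b" and lim: "b \<longlonglongrightarrow> 0" and sm: "summable (\<lambda>n. v n * of_real (b n))"
  shows "norm (\<Sum>n. v n * of_real (b n)) \<le> (\<Sum>c<p. norm (v c)) * b 0"
proof -
  let ?V = "\<Sum>c<p. norm (v c)"
  have v: "v (c + m * p) = v c" for m c
  proof (induction m)
    case (Suc m)
    have "c + Suc m * p = (c + m * p) + p" by simp
    then show ?case using per Suc.IH by presburger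
  qed simp
  define B where "B m = (\<Sum>n\<in>{m * p..<m * p + p}. v n * of_real (b n))" for m
  have B: "B sums (\<Sum>n. v n * of_real (b n))"
    unfolding B_def by (rule sums_group[OF summable_sums[OF sm] p])
  have nB: "norm (B m) \<le> ?V * (b (m * p) - b (Suc m * p))" for m
  proof -
    have "B m = (\<Sum>c\<in>{0..<p}. v (c + m * p) * of_real (b (c + m * p)))"
      unfolding B_def using sum.shift_bounds_nat_ivl[of "\<lambda>n. v n * of_real (b n)" 0 "m * p" p]
      by (simp only: add_0 add.commute[of p])
    also have "\<dots> = (\<Sum>c<p. v c * of_real (b (m * p + c)))"
      by (simp only: v lessThan_atLeast0 add.commute[of "m * p"])
    also have "\<dots> = (\<Sum>c<p. v c * of_real (b (m * p + c) - b (m * p)))"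
      using mean by (simp add: right_diff_distrib sum_subtractf sum_distrib_right [symmetric])
    finally have Bm: "B m = (\<Sum>c<p. v c * of_real (b (m * p + c) - b (m * p)))" .
    have "norm (B m) \<le> (\<Sum>c<p. norm (v c) * (b (m * p) - b (Suc m * p)))"
      unfolding Bm
    proof (rule sum_norm_le)
      fix c assume c: "c \<in> {..<p}"
      have "b (m * p + c) \<le> b (m * p)" "b (Suc m * p) \<le> b (m * p + c)"
        using c by (auto intro!: decseqD[OF dec])
      then have "norm (complex_of_real (b (m * p + c) - b (m * p))) \<le> b (m * p) - b (Suc m * p)"
        unfolding norm_of_real by linarith
      then show "norm (v c * of_real (b (m * p + c) - b (m * p))) \<le> norm (v c) * (b (m * p) - b (Suc m * p))"
        unfolding norm_mult by (rule mult_left_mono) simp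
    qed
    then show ?thesis by (simp add: sum_distrib_right)
  qed
  have "(\<lambda>m. b (m * p)) \<longlonglongrightarrow> 0"
    by (rule filterlim_compose[OF lim]) (use p in \<open>simp add: filterlim_at_top_mult_tendsto_pos mult_nat_right_at_top\<close>)
  from telescope_sums'[OF this]
  have T: "(\<lambda>m. ?V * (b (m * p) - b (Suc m * p))) sums (?V * b 0)"
    using sums_mult[of "\<lambda>m. b (m * p) - b (Suc m * p)" "b 0" ?V] by simp
  have "norm (\<Sum>m. B m) \<le> (\<Sum>m. ?V * (b (m * p) - b (Suc m * p)))"
    by (rule norm_suminf_le) (use nB T in \<open>auto simp: sums_iff\<close>)
  then show ?thesis using B T by (simp add: sums_iff)
qed

text \<open>Factoring 2 = 1 - (-w)^p gives |1 + w| >= 2/p, and |1 + w| is at most twice |1 + t w|.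
  Unlike \<open>norm_one_plus_ge\<close>, this does not degenerate as |q| tends to 1.\<close>

lemma norm_one_plus_root_ge:
  fixes w :: complex
  assumes "w ^ p = 1" "odd p" "0 \<le> t"
  shows "1 / real p \<le> norm (1 + of_real t * w)"
proof -
  have p: "p > 0" using assms(2) by (rule odd_pos)
  have nw: "norm w = 1"
    using power_eq_1_iff[OF assms(1)] p by simp
  have "(1 - (- w) ^ p) = (1 - (- w)) * (\<Sum>i<p. (- w) ^ i)" by (rule one_diff_power_eq)
  then have "(2 :: complex) = (1 + w) * (\<Sum>i<p. (- w) ^ i)" using assms by simp
  then have "2 = norm (1 + w) * norm (\<Sum>i<p. (- w) ^ i)" by (metis norm_mult norm_numeral)
  also have "\<dots> \<le> norm (1 + w) * real p"
  proof (intro mult_left_mono norm_ge_zero)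
    have "norm (\<Sum>i<p. (- w) ^ i) \<le> (\<Sum>i<p. 1)"
      by (rule sum_norm_le) (simp add: norm_power nw)
    then show "norm (\<Sum>i<p. (- w) ^ i) \<le> real p" by simp
  qed
  finally have 1: "2 / real p \<le> norm (1 + w)" using p by (simp add: field_simps)
  have "norm (1 + w) \<le> norm (1 + of_real t * w) + norm ((1 - of_real t) * w)"
    using norm_triangle_ineq[of "1 + of_real t * w" "(1 - of_real t) * w"] by (simp add: algebra_simps)
  also have "norm ((1 - of_real t) * w) = \<bar>1 - t\<bar>"
    by (metis norm_mult nw mult_1_right norm_of_real of_real_1 of_real_diff)
  also have "\<bar>1 - t\<bar> \<le> norm (1 + of_real t * w)"
    using norm_triangle_ineq3[of 1 "- (of_real t * w)"] assms(3) by (simp add: norm_mult nw)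
  finally show ?thesis using 1 by simp
qed

lemma summable_real_ptheta:
  fixes r x :: real
  assumes "0 \<le> r" "r < 1" "0 \<le> x"
  shows "summable (\<lambda>n. r ^ (n * (n + 1)) * x ^ n)"
  using summable_ptheta_norm[of "of_real r" "of_real x"] assms
  by (simp add: norm_mult norm_power)

lemma real_ptheta_at_top:
  "filterlim (\<lambda>r :: real. \<Sum>n. r ^ (n * (n + 1))) at_top (at_left 1)"
  unfolding filterlim_at_top
proof
  fix Z :: real
  obtain N where N: "Z < real N" using reals_Archimedean2 by blast
  have "((\<lambda>r :: real. \<Sum>n<N. r ^ (n * (n + 1))) \<longlongrightarrow> (\<Sum>n<N. 1 ^ (n * (n + 1)))) (at_left 1)"
    by (intro tendsto_intros)
  then have "\<forall>\<^sub>F r in at_left 1. Z < (\<Sum>n<N. r ^ (n * (n + 1)))"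
    using N by (intro order_tendstoD(1)) auto
  moreover have "\<forall>\<^sub>F r :: real in at_left 1. 0 < r \<and> r < 1"
    using eventually_at_left_real[OF zero_less_one] by eventually_elim auto
  ultimately show "\<forall>\<^sub>F r in at_left 1. Z \<le> (\<Sum>n. r ^ (n * (n + 1)))"
  proof eventually_elim
    case (elim r)
    have "(\<Sum>n<N. r ^ (n * (n + 1))) \<le> (\<Sum>n. r ^ (n * (n + 1)))"
      using elim summable_real_ptheta[of r 1] by (intro sum_le_suminf) auto
    then show ?case using elim by linarith
  qed
qed

text \<open>The coefficients z^(n(n+1)) have period \<open>p\<close> and mean G/p. The mean produces
  the growing term, and the fluctuation contributes an amount bounded independently of r.\<close>

lemma ptheta_root_of_unity_ge:
  fixes z :: complex and r :: real
  assumes z: "z ^ p = 1" "0 < p" and r: "0 < r" "r < 1"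
  defines "G \<equiv> (\<Sum>n<p. z ^ (n * (n + 1)))"
  shows "norm G / real p * (\<Sum>n. r ^ (n * (n + 1))) - (\<Sum>n<p. norm (z ^ (n * (n + 1)) - G / of_nat p))
    \<le> norm (ptheta (of_real r * z) 1)"
proof -
  let ?s = "\<lambda>n. r ^ (n * (n + 1))"
  define v where "v n = z ^ (n * (n + 1)) - G / of_nat p" for n
  have sms: "summable ?s" using summable_real_ptheta[of r 1] r by simp
  have nz: "norm z = 1"
    using power_eq_1_iff[OF z(1)] z(2) by simp
  have "norm (of_real r * z) < 1" using r by (simp add: norm_mult nz)
  from summable_ptheta[OF this, of 1]
  have smq: "summable (\<lambda>n. z ^ (n * (n + 1)) * of_real (?s n))"
    by (simp add: power_mult_distrib mult.commute)
  have smG: "summable (\<lambda>n. G / of_nat p * complex_of_real (?s n))"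
    by (intro summable_mult summable_of_real sms)
  have e: "ptheta (of_real r * z) 1 = (\<Sum>n. z ^ (n * (n + 1)) * of_real (?s n))"
    by (simp add: ptheta_def power_mult_distrib mult.commute)
  have "(\<Sum>n. v n * of_real (?s n)) = ptheta (of_real r * z) 1 - G / of_nat p * of_real (\<Sum>n. ?s n)"
    unfolding e v_def left_diff_distrib suminf_of_real[OF sms]
    by (subst suminf_diff [symmetric], intro smq, intro smG)
      (subst suminf_mult, intro summable_of_real sms, rule refl)
  moreover have "norm (\<Sum>n. v n * of_real (?s n)) \<le> (\<Sum>c<p. norm (v c)) * ?s 0"
  proof (rule norm_suminf_periodic_decseq_le[OF z(2)])
    show "v (n + p) = v n" for n
    proof -
      have "(n + p) * (n + p + 1) = n * (n + 1) + p * (2 * n + p + 1)" by (simp add: algebra_simps)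
      moreover have "z ^ (p * (2 * n + p + 1)) = 1" unfolding power_mult[of z p] z(1) by simp
      ultimately show ?thesis unfolding v_def by (metis power_add mult_1_right)
    qed
    show "(\<Sum>c<p. v c) = 0" using z(2) by (simp add: v_def sum_subtractf G_def)
    show "decseq ?s" using r by (intro decseq_SucI power_decreasing) auto
    show "?s \<longlonglongrightarrow> 0" by (rule summable_LIMSEQ_zero[OF sms])
    show "summable (\<lambda>n. v n * of_real (?s n))"
      unfolding v_def left_diff_distrib by (intro summable_diff smq smG)
  qed
  moreover have "norm (G / of_nat p * of_real (\<Sum>n. ?s n)) = norm G / real p * (\<Sum>n. ?s n)"
    using suminf_nonneg[OF sms] r by (simp add: norm_mult norm_divide)
  ultimately show ?thesis
    using norm_triangle_ineq2[of "G / of_nat p * of_real (\<Sum>n. ?s n)" "ptheta (of_real r * z) 1"]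
    by (simp add: norm_minus_commute v_def)
qed

text \<open>The factor multiplying the sum of r^(n(n+1)) tends to 1 + 1 - 2 = 0 as r tends to 1, so
  the difference is of smaller order than that sum. Writing p = Suc m expresses p(p - 1) without
  natural subtraction.\<close>

lemma bapp_diff_bound:
  fixes z :: complex and r :: real
  assumes z: "z ^ p = 1" and p: "odd p" "p = Suc m" and r: "0 < r" "r < 1"
  defines "q \<equiv> of_real r * z" and "\<Theta> \<equiv> (\<Sum>n. r ^ (n * (n + 1)))"
  shows "norm (bapp q (q ^ (2 * p)) - bapp q 1)
    \<le> real p * ((1 / r ^ (p * (p + 1)) + 1 / r ^ (p * m) - 2) * \<Theta> + real p / r ^ (2 * p * p))"
proof -
  define \<rho> where "\<rho> = r ^ (2 * p)"
  let ?s = "\<lambda>n. r ^ (n * (n + 1))"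
  define D where "D n = ?s n * (\<rho> ^ n + (1 / \<rho>) ^ n - 2)" for n
  have \<rho>: "0 < \<rho>" using r by (simp add: \<rho>_def)
  have nz: "norm z = 1"
    using power_eq_1_iff[OF z] p(2) by simp
  have nq: "norm q < 1" using r by (simp add: q_def norm_mult nz)
  have q\<rho>: "q ^ (2 * p) = of_real \<rho>"
  proof -
    have "z ^ (2 * p) = 1" using z by (metis mult.commute power_mult power_one)
    then show ?thesis by (simp add: q_def \<rho>_def power_mult_distrib)
  qed
  have sm: "summable (\<lambda>n. ?s n * x ^ n)" if "0 \<le> x" for x
    using summable_real_ptheta[of r x] that r by simp
  have sm1: "summable ?s" using sm[of 1] by simp
  \<comment> \<open>By symmetry under inversion the difference carries the weights \<rho>^n +
    \<rho>^(-n) - 2. They are nonnegative, so termwise bounds keep their cancellation.\<close>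
  have ge: "0 \<le> \<rho> ^ n + (1 / \<rho>) ^ n - 2" for n
  proof -
    have "0 \<le> (\<rho> ^ n - 1) ^ 2 / \<rho> ^ n" using \<rho> by simp
    also have "\<dots> = \<rho> ^ n + (1 / \<rho>) ^ n - 2"
      using \<rho> by (simp add: field_simps power2_eq_square)
    finally show ?thesis .
  qed
  have Dsum: "D sums ((\<Sum>n. ?s n * \<rho> ^ n) + (\<Sum>n. ?s n * (1 / \<rho>) ^ n) - \<Theta> * 2)"
  proof -
    have D: "D = (\<lambda>n. (?s n * \<rho> ^ n + ?s n * (1 / \<rho>) ^ n) - ?s n * 2)"
      unfolding D_def by (rule ext) (simp only: distrib_left[of "?s _"] right_diff_distrib[of "?s _"])
    show ?thesis
      unfolding D \<Theta>_def using \<rho>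
      by (intro sums_diff sums_add sums_mult2 summable_sums sm sm1) simp_all
  qed

  let ?w = "\<lambda>n. q ^ (Suc n * (Suc n + 1)) / (1 + q ^ (2 * Suc n))"
  have "bapp q (q ^ (2 * p)) - bapp q 1 = papp q (of_real \<rho>) + papp q (1 / of_real \<rho>) - (papp q 1 + papp q 1)"
    by (simp add: bapp_def q\<rho>)
  also have "\<dots> = (\<Sum>n. ?w n * of_real \<rho> ^ Suc n + ?w n * (1 / of_real \<rho>) ^ Suc n
      - (?w n * 1 ^ Suc n + ?w n * 1 ^ Suc n))"
    unfolding papp_def
    by (intro sums_unique sums_diff sums_add summable_sums summable_papp nq)
  finally have diff: "bapp q (q ^ (2 * p)) - bapp q 1 = (\<Sum>n. ?w n * of_real \<rho> ^ Suc n
      + ?w n * (1 / of_real \<rho>) ^ Suc n - (?w n * 1 ^ Suc n + ?w n * 1 ^ Suc n))" .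
  have "norm (bapp q (q ^ (2 * p)) - bapp q 1) \<le> (\<Sum>n. real p * D (Suc n))"
    unfolding diff
  proof (rule norm_suminf_le)
    have "summable (\<lambda>n. D (Suc n))" using Dsum by (simp add: sums_iff summable_Suc_iff)
    then show "summable (\<lambda>n. real p * D (Suc n))" by (rule summable_mult)
    fix n
    have w: "norm (?w n) \<le> real p * ?s (Suc n)"
    proof -
      have "q ^ (2 * Suc n) = of_real (r ^ (2 * Suc n)) * z ^ (2 * Suc n)"
        by (simp only: q_def power_mult_distrib of_real_power)
      moreover have "(z ^ (2 * Suc n)) ^ p = 1" using z by (metis mult.commute power_mult power_one)
      ultimately have "1 / real p \<le> norm (1 + q ^ (2 * Suc n))"
        using norm_one_plus_root_ge[of "z ^ (2 * Suc n)" p "r ^ (2 * Suc n)"] p(1) r by simp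
      then have "?s (Suc n) / norm (1 + q ^ (2 * Suc n)) \<le> ?s (Suc n) / (1 / real p)"
        using r p(2) by (intro divide_left_mono mult_pos_pos) (auto intro: less_le_trans[of 0 "1 / real p"])
      moreover have "norm (q ^ (Suc n * (Suc n + 1))) = ?s (Suc n)"
        using r by (simp add: q_def norm_power norm_mult nz del: power_Suc mult_Suc)
      ultimately show ?thesis by (simp only: norm_divide) (simp add: mult.commute)
    qed
    let ?e = "\<rho> ^ Suc n + (1 / \<rho>) ^ Suc n - 2"
    have split: "?w n * of_real \<rho> ^ Suc n + ?w n * (1 / of_real \<rho>) ^ Suc n - (?w n * 1 ^ Suc n + ?w n * 1 ^ Suc n)
        = ?w n * of_real ?e"
      by (simp only: of_real_add of_real_diff of_real_power of_real_divide of_real_1 of_real_numeral power_one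
          right_diff_distrib distrib_left mult_2_right mult_1_right)
    have "norm (?w n * of_real ?e) = norm (?w n) * ?e"
      by (simp only: norm_mult norm_of_real abs_of_nonneg[OF ge])
    also have "\<dots> \<le> real p * ?s (Suc n) * ?e" by (rule mult_right_mono[OF w ge])
    also have "\<dots> = real p * D (Suc n)" by (simp only: D_def mult.assoc)
    finally show "norm (?w n * of_real \<rho> ^ Suc n + ?w n * (1 / of_real \<rho>) ^ Suc n
        - (?w n * 1 ^ Suc n + ?w n * 1 ^ Suc n)) \<le> real p * D (Suc n)"
      by (simp only: split)
  qed
  also have "\<dots> = real p * (\<Sum>n. D n)"
  proof -
    have sD: "summable D" by (rule sums_summable[OF Dsum])
    then have sS: "summable (\<lambda>n. D (Suc n))" by (simp only: summable_Suc_iff)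
    have "(\<Sum>n. D (Suc n)) = suminf D - D 0" by (rule suminf_split_head[OF sD])
    also have "D 0 = 0" by (simp add: D_def)
    finally show ?thesis by (simp only: suminf_mult[OF sS] diff_zero)
  qed
  finally have main: "norm (bapp q (q ^ (2 * p)) - bapp q 1) \<le> real p * (\<Sum>n. D n)" .
  have Deq: "(\<Sum>n. D n) = (\<Sum>n. ?s n * \<rho> ^ n) + (\<Sum>n. ?s n * (1 / \<rho>) ^ n) - \<Theta> * 2"
    by (rule sums_unique[OF Dsum, symmetric])
  \<comment> \<open>Completing the square shifts n to n + p; the omitted initial terms are
    nonnegative.\<close>
  have up: "(\<Sum>n. ?s n * \<rho> ^ n) \<le> 1 / r ^ (p * (p + 1)) * \<Theta>"
  proof -
    have "?s n * \<rho> ^ n = 1 / r ^ (p * (p + 1)) * ?s (n + p)" for n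
    proof -
      have "n * (n + 1) + 2 * p * n + p * (p + 1) = (n + p) * (n + p + 1)" by (simp add: algebra_simps)
      then have "?s n * \<rho> ^ n * r ^ (p * (p + 1)) = ?s (n + p)"
        unfolding \<rho>_def power_mult [symmetric] power_add [symmetric] by (simp only:)
      then show ?thesis using r by (simp add: field_simps)
    qed
    then have "(\<Sum>n. ?s n * \<rho> ^ n) = 1 / r ^ (p * (p + 1)) * (\<Sum>n. ?s (n + p))"
      by (simp only: suminf_mult[OF summable_ignore_initial_segment[OF sm1, of p]])
    also have "\<dots> \<le> 1 / r ^ (p * (p + 1)) * \<Theta>"
      using suminf_split_initial_segment[OF sm1, of p] r
      by (intro mult_left_mono) (auto simp: \<Theta>_def intro!: sum_nonneg)
    finally show ?thesis .
  qed
  \<comment> \<open>The opposite shift reproduces the full series from index p on; each of the first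
    \<open>p\<close> terms is at most 1 / r^(2 p p).\<close>
  have down: "(\<Sum>n. ?s n * (1 / \<rho>) ^ n) \<le> 1 / r ^ (p * m) * \<Theta> + real p / r ^ (2 * p * p)"
  proof -
    have tail: "?s (n + p) * (1 / \<rho>) ^ (n + p) = 1 / r ^ (p * m) * ?s n" for n
    proof -
      have "(n + p) * (n + p + 1) + p * m = n * (n + 1) + 2 * p * (n + p)"
        unfolding p(2) by (simp add: algebra_simps)
      then have "?s (n + p) * r ^ (p * m) = ?s n * \<rho> ^ (n + p)"
        unfolding \<rho>_def power_mult [symmetric] power_add [symmetric] by (simp only:)
      then show ?thesis using r \<rho> by (simp add: field_simps)
    qed
    have "(\<Sum>n. ?s n * (1 / \<rho>) ^ n) = (\<Sum>n. ?s (n + p) * (1 / \<rho>) ^ (n + p)) + (\<Sum>n<p. ?s n * (1 / \<rho>) ^ n)"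
      using \<rho> by (intro suminf_split_initial_segment sm) simp
    also have "(\<Sum>n. ?s (n + p) * (1 / \<rho>) ^ (n + p)) = 1 / r ^ (p * m) * \<Theta>"
      unfolding tail \<Theta>_def by (rule suminf_mult[OF sm1])
    also have "(\<Sum>n<p. ?s n * (1 / \<rho>) ^ n) \<le> (\<Sum>n<p. 1 / r ^ (2 * p * p))"
    proof (rule sum_mono)
      fix n assume n: "n \<in> {..<p}"
      have "?s n * (1 / \<rho>) ^ n \<le> 1 * (1 / \<rho>) ^ n"
        using r \<rho> by (intro mult_right_mono power_le_one) auto
      also have "\<dots> = 1 / r ^ (2 * p * n)" by (simp add: \<rho>_def power_divide power_mult)
      also have "\<dots> \<le> 1 / r ^ (2 * p * p)"
        using r n by (intro divide_left_mono power_decreasing mult_pos_pos) auto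
      finally show "?s n * (1 / \<rho>) ^ n \<le> 1 / r ^ (2 * p * p)" .
    qed
    finally show ?thesis by simp
  qed
  have "(\<Sum>n. D n) \<le> (1 / r ^ (p * (p + 1)) + 1 / r ^ (p * m) - 2) * \<Theta> + real p / r ^ (2 * p * p)"
    using up down unfolding Deq distrib_right left_diff_distrib by linarith
  with main show ?thesis by (meson mult_left_mono of_nat_0_le_iff order_trans)
qed

section \<open>The radial limit\<close>

theorem theorem4p2:
  fixes k :: nat and \<zeta> :: complex
  assumes "primitive_root_of_unity (2 * k + 1) \<zeta>"
  shows "((\<lambda>r::real. let q = complex_of_real r * \<zeta> in
            2 * S2_one q - theta_J_bar 1 2 q ^ 3 / (2 * theta_J 1 4 q ^ 2))
          \<longlongrightarrow> - 2 * (\<Sum>n=0..k. qpoch \<zeta> (\<zeta> ^ 2) n ^ 2 * \<zeta> ^ (2 * n + 1) / qpoch (- \<zeta>) \<zeta> (2 * n + 1)))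
         (at_left 1)"
proof -
  define p where "p = 2 * k + 1"
  have p: "odd p" "p = Suc (2 * k)" "0 < p" by (simp_all add: p_def)
  have zp: "\<zeta> ^ p = 1" using assms by (simp add: primitive_root_of_unity_def p_def)
  have nz: "norm \<zeta> = 1" using power_eq_1_iff[OF zp] p(3) by simp
  then have z0: "\<zeta> \<noteq> 0" by auto
  define G where "G = (\<Sum>n<p. \<zeta> ^ (n * (n + 1)))"
  define c where "c = norm G / real p"
  define V where "V = (\<Sum>n<p. norm (\<zeta> ^ (n * (n + 1)) - G / of_nat p))"
  have c: "0 < c" using gauss_sum_nonzero[OF assms] p(3) by (simp add: c_def G_def p_def)
  define \<Theta> where "\<Theta> r = (\<Sum>n. r ^ (n * (n + 1)))" for r :: real
  have \<Theta>: "filterlim \<Theta> at_top (at_left 1)" unfolding \<Theta>_def by (rule real_ptheta_at_top)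
  define Q where "Q r = complex_of_real r * \<zeta>" for r
  \<comment> \<open>\<open>bapp_iterate\<close> turns the target function into \<open>err\<close>
    minus the alternating finite sum, which is continuous at r = 1.\<close>
  define err where "err r = (bapp (Q r) (Q r ^ (2 * p)) - bapp (Q r) 1) / btheta (Q r) 1" for r
  define e1 where "e1 r = 1 / r ^ (p * (p + 1)) + 1 / r ^ (p * (2 * k)) - 2" for r :: real
  define e2 where "e2 r = real p / r ^ (2 * p * p)" for r :: real
  have unit: "\<forall>\<^sub>F r :: real in at_left 1. 0 < r \<and> r < 1"
    using eventually_at_left_real[OF zero_less_one] by eventually_elim auto
  \<comment> \<open>This makes \<open>btheta (Q r) 1\<close> nonzero, as \<open>S2_one_eq\<close>
    requires, and of size at least c times \<open>\<Theta> r\<close>.\<close>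
  have big: "\<forall>\<^sub>F r in at_left 1. \<Theta> r > 0 \<and> c - V / \<Theta> r > c / 2"
  proof -
    have "((\<lambda>r. c - V / \<Theta> r) \<longlongrightarrow> c - 0) (at_left 1)"
      by (intro tendsto_intros real_tendsto_divide_at_top[OF tendsto_const \<Theta>])
    then have "\<forall>\<^sub>F r in at_left 1. c / 2 < c - V / \<Theta> r"
      by (rule order_tendstoD) (use c in simp)
    moreover have "\<forall>\<^sub>F r in at_left 1. 0 < \<Theta> r"
      using \<Theta> by (simp add: filterlim_at_top_dense)
    ultimately show ?thesis by eventually_elim simp
  qed
  have lower: "2 * \<Theta> r * (c - V / \<Theta> r) \<le> norm (btheta (Q r) 1)"
    if "0 < r" "r < 1" "\<Theta> r > 0" for r
  proof -
    have "2 * \<Theta> r * (c - V / \<Theta> r) = 2 * (c * \<Theta> r - V)" using that(3) by (simp add: field_simps)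
    also have "\<dots> \<le> 2 * norm (ptheta (Q r) 1)"
      using ptheta_root_of_unity_ge[OF zp p(3) that(1,2)]
      by (simp add: G_def c_def V_def \<Theta>_def Q_def)
    \<comment> \<open>At x = 1 the two folded halves coincide.\<close>
    also have "\<dots> = norm (btheta (Q r) 1)"
      by (simp add: btheta_def norm_mult flip: mult_2)
    finally show ?thesis .
  qed
  have "(err \<longlongrightarrow> 0) (at_left 1)"
  proof (rule Lim_null_comparison)
    show "\<forall>\<^sub>F r in at_left 1. norm (err r) \<le> real p * (e1 r + e2 r / \<Theta> r) / c"
      using unit big
    proof eventually_elim
      case (elim r)
      have "\<Theta> r * c \<le> 2 * \<Theta> r * (c - V / \<Theta> r)"
        using elim mult_left_mono[of "c / 2" "c - V / \<Theta> r" "2 * \<Theta> r"] by simp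
      then have th: "\<Theta> r * c \<le> norm (btheta (Q r) 1)" using lower[of r] elim by linarith
      have "norm (bapp (Q r) (Q r ^ (2 * p)) - bapp (Q r) 1) \<le> real p * (e1 r * \<Theta> r + e2 r)"
        using bapp_diff_bound[OF zp p(1,2), of r] elim by (simp add: Q_def \<Theta>_def e1_def e2_def)
      then have "norm (err r) \<le> real p * (e1 r * \<Theta> r + e2 r) / (\<Theta> r * c)"
        unfolding err_def norm_divide using th elim c
        by (intro frac_le order_trans[OF norm_ge_zero]) auto
      also have "\<dots> = real p * (e1 r + e2 r / \<Theta> r) / c"
        using elim c by (simp add: field_simps)
      finally show ?case .
    qed
    have e2: "(e2 \<longlongrightarrow> real p / 1 ^ (2 * p * p)) (at_left 1)"
      unfolding e2_def by (intro tendsto_intros) auto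
    have "((\<lambda>r. real p * (e1 r + e2 r / \<Theta> r) / c)
        \<longlongrightarrow> real p * ((1 / 1 ^ (p * (p + 1)) + 1 / 1 ^ (p * (2 * k)) - 2) + 0) / c) (at_left 1)"
      unfolding e1_def
      by (intro tendsto_intros real_tendsto_divide_at_top[OF e2 \<Theta>]) (use c in auto)
    then show "((\<lambda>r. real p * (e1 r + e2 r / \<Theta> r) / c) \<longlongrightarrow> 0) (at_left 1)" by simp
  qed
  moreover have "((\<lambda>r. \<Sum>i<p. (- 1) ^ i / Q r ^ (i * (i + 1))) \<longlongrightarrow>
      (\<Sum>i<p. (- 1) ^ i / (complex_of_real 1 * \<zeta>) ^ (i * (i + 1)))) (at_left 1)"
    unfolding Q_def using z0 by (intro tendsto_intros) auto
  ultimately have "((\<lambda>r. err r - (\<Sum>i<p. (- 1) ^ i / Q r ^ (i * (i + 1)))) \<longlongrightarrow>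
      0 - (\<Sum>i<p. (- 1) ^ i / (complex_of_real 1 * \<zeta>) ^ (i * (i + 1)))) (at_left 1)"
    by (rule tendsto_diff)
  \<comment> \<open>Twice the \<open>dual_term\<close> sum over a full period is the alternating
    sum, and truncation at k leaves the stated right-hand side.\<close>
  also have "0 - (\<Sum>i<p. (- 1) ^ i / (complex_of_real 1 * \<zeta>) ^ (i * (i + 1)))
      = - 2 * (\<Sum>n=0..k. qpoch \<zeta> (\<zeta> ^ 2) n ^ 2 * \<zeta> ^ (2 * n + 1) / qpoch (- \<zeta>) \<zeta> (2 * n + 1))"
    using zp sum_dual_term_root_of_unity[of \<zeta> k] sum_dual_term_truncate[of \<zeta> k] by (simp add: p_def)
  finally have lim: "((\<lambda>r. err r - (\<Sum>i<p. (- 1) ^ i / Q r ^ (i * (i + 1)))) \<longlongrightarrow>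
      - 2 * (\<Sum>n=0..k. qpoch \<zeta> (\<zeta> ^ 2) n ^ 2 * \<zeta> ^ (2 * n + 1) / qpoch (- \<zeta>) \<zeta> (2 * n + 1))) (at_left 1)" .
  show ?thesis
  proof (rule Lim_transform_eventually[OF lim])
    show "\<forall>\<^sub>F r in at_left 1. err r - (\<Sum>i<p. (- 1) ^ i / Q r ^ (i * (i + 1)))
        = (let q = complex_of_real r * \<zeta> in 2 * S2_one q - theta_J_bar 1 2 q ^ 3 / (2 * theta_J 1 4 q ^ 2))"
      using unit big
    proof eventually_elim
      case (elim r)
      have q: "Q r \<noteq> 0" "norm (Q r) < 1" using elim z0 nz by (simp_all add: Q_def norm_mult)
      have "0 < c - V / \<Theta> r" using elim c by linarith
      then have "0 < 2 * \<Theta> r * (c - V / \<Theta> r)" using elim by simp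
      then have th: "btheta (Q r) 1 \<noteq> 0" using lower[of r] elim by auto
      have "bapp (Q r) (Q r ^ (2 * p))
          = btheta (Q r) 1 * (\<Sum>i<p. (- 1) ^ i / Q r ^ (i * (i + 1))) - bapp (Q r) 1"
        using bapp_iterate[OF q p(1)] by (simp only: eq_diff_eq)
      then have "err r - (\<Sum>i<p. (- 1) ^ i / Q r ^ (i * (i + 1))) = - (2 * bapp (Q r) 1 / btheta (Q r) 1)"
        using th by (simp add: err_def diff_divide_distrib)
      also have "\<dots> = 2 * S2_one (Q r) - theta_J_bar 1 2 (Q r) ^ 3 / (2 * theta_J 1 4 (Q r) ^ 2)"
        by (rule S2_one_eq[OF q th, symmetric])
      finally show ?case by (simp add: Q_def Let_def)
    qed
  qed
qed

end
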